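(* Let $(X,d,\mu)$ be a connected and locally connected metric probability space, and let $\omega:[0,\infty)\to[0,\infty]$ be non-decreasing. For every $\varepsilon>0$ there is some integer $p\geq 1$, depending on $X$, $\varepsilon$ and $\omega$, with the following property. For every $N\geq 1$, if $f:X^N\to\mathbb{R}$ has modulus of continuity at most $\omega$ for the metric $d^N_\infty$, then there is $S\subseteq[N]$ with $|S|\leq p$ such that \[\|f-E_Sf\|_{L_1(\mu^N)}<\varepsilon.\]
   Context: A metric probability space is a triple $(X,d,\mu)$ where $d$ is a compact metric on $X$ and $\mu$ is a probability measure on the Borel $\sigma$-algebra of $(X,d)$. It is called connected (resp. locally connected) if the support $\mathrm{spt}\,\mu$ is connected (resp. locally connected). $\mu^N$ is the $N$-fold product measure on $X^N$, and \[d^N_\infty((x_n)_{n\leq N},(x_n')_{n\leq N}):=\max_{n\leq N}d(x_n,x'_n).\] For a metric space $(Y,\rho)$ and a function $f:Y\to\mathbb{R}$, the (non-decreasing) modulus of continuity of $f$ is the function $\omega_f:[0,\infty)\to[0,\infty]$ given by $\omega_f(r):=\sup\{|f(x)-f(y)| : \rho(x,y)\leq r\}$; "modulus of continuity at most $\omega$" means $\omega_f(r)\leq\omega(r)$ for all $r\geq 0$. $[N]=\{1,\ldots,N\}$. For $n\in[N]$, $E_{[N]\setminus\{n\}}$ is the conditional expectation operator on $L_1(\mu^N)$ integrating out the $n$-th coordinate: \[E_{[N]\setminus\{n\}}f(x_1,\ldots,x_N):=\int_X f(x_1,\ldots,x_{n-1},y,x_{n+1},\ldots,x_N)\,\mu(\mathrm{d}y).\]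 For $S=[N]\setminus\{n_1,\ldots,n_k\}$, $E_S:=E_{[N]\setminus\{n_1\}}\circ\cdots\circ E_{[N]\setminus\{n_k\}}$ (the order of composition is unimportant; $E_{[N]}$ is the identity). Thus $E_Sf$ depends only on the coordinates in $S$.
   Formalization: The formal theorem additionally assumes that ω(r) → 0 as r → 0+; without this the claim fails (X=[0,1], ω≡1, f a product of ±1/2-scaled sign functions of all coordinates). *)

theory Defs
  imports "HOL-Probability.Probability"
begin

text \<open>The compact metric space is the whole type \<open>'a\<close>, with metric \<^const>\<open>dist\<close>.\<close>

definition metric_prob_space :: "'a::metric_space measure \<Rightarrow> bool" where
  "metric_prob_space \<mu> \<longleftrightarrow>
     compact (UNIV :: 'a set) \<and> prob_space \<mu> \<and> sets \<mu> = sets borel"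

definition spt :: "'a::topological_space measure \<Rightarrow> 'a set" where
  "spt \<mu> = {x. \<forall>U. open U \<and> x \<in> U \<longrightarrow> emeasure \<mu> U > 0}"

text \<open>
  The index set \<open>[N]\<close> is \<open>{1..N}\<close>; points of \<open>X\<^sup>N\<close> are the extensional functions
  on \<open>{1..N}\<close>, so that \<open>X\<^sup>N\<close> is the space of the library product measure.
\<close>

definition pow_space :: "nat \<Rightarrow> (nat \<Rightarrow> 'a) set" where
  "pow_space N = PiE {1..N} (\<lambda>_. UNIV)"

definition pow_measure :: "nat \<Rightarrow> 'a measure \<Rightarrow> (nat \<Rightarrow> 'a) measure" where
  "pow_measure N \<mu> = PiM {1..N} (\<lambda>_. \<mu>)"

text \<open>Only meaningful for \<open>N \<ge> 1\<close>, since \<^const>\<open>Max\<close> is unspecified on the empty set.\<close>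

definition dist_inf :: "nat \<Rightarrow> (nat \<Rightarrow> 'a::metric_space) \<Rightarrow> (nat \<Rightarrow> 'a) \<Rightarrow> real" where
  "dist_inf N x y = Max ((\<lambda>n. dist (x n) (y n)) ` {1..N})"

definition modulus_of_continuity ::
    "'b set \<Rightarrow> ('b \<Rightarrow> 'b \<Rightarrow> real) \<Rightarrow> ('b \<Rightarrow> real) \<Rightarrow> real \<Rightarrow> ennreal" where
  "modulus_of_continuity Y \<rho> f r =
     Sup {ennreal \<bar>f x - f y\<bar> | x y. x \<in> Y \<and> y \<in> Y \<and> \<rho> x y \<le> r}"

definition integrate_out ::
    "'a measure \<Rightarrow> nat \<Rightarrow> ((nat \<Rightarrow> 'a) \<Rightarrow> real) \<Rightarrow> (nat \<Rightarrow> 'a) \<Rightarrow> real" where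
  "integrate_out \<mu> n f = (\<lambda>x. \<integral>y. f (x(n := y)) \<partial>\<mu>)"

text \<open>
  The composition of the operators \<open>integrate_out \<mu> n\<close> for \<open>n\<close> in \<open>{1..N} - S\<close>. By Fubini the
  order is immaterial for integrable functions, up to null sets; the increasing order is fixed.
\<close>

definition cond_exp_on ::
    "nat \<Rightarrow> 'a measure \<Rightarrow> nat set \<Rightarrow> ((nat \<Rightarrow> 'a) \<Rightarrow> real) \<Rightarrow> (nat \<Rightarrow> 'a) \<Rightarrow> real" where
  "cond_exp_on N \<mu> S f = foldr (integrate_out \<mu>) (sorted_list_of_set ({1..N} - S)) f"

text \<open>
  Valued in \<^typ>\<open>ennreal\<close>, so that a bound on the norm is not satisfied vacuously by the
  Bochner convention that the integral of a non-integrable function is zero.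
\<close>

definition L1_norm :: "'b measure \<Rightarrow> ('b \<Rightarrow> real) \<Rightarrow> ennreal" where
  "L1_norm M f = (\<integral>\<^sup>+x. ennreal \<bar>f x\<bar> \<partial>M)"

end

theory Submission
  imports Defs
begin

text \<open>
  Fix a small scale \<open>\<delta>\<close>. Since the support is connected, a finite net of it can be traversed by a walk
  with steps \<open>O(\<delta>)\<close>, and \<open>\<mu>\<close> is, up to moving every point by \<open>O(\<delta>)\<close>, the image of Lebesgue measure
  on \<open>[0, 1)\<close> under a step function following that walk. As \<open>f\<close> changes little when all
  coordinates move by \<open>O(\<delta>)\<close> at once, it may be replaced by a function on a grid \<open>{..<2\<^sup>M}\<^sup>N\<close>.
  Inf-convolution makes this function Lipschitz for the sup metric, with a constant depending only
  on the walk; averaging over small boxes then bounds the sum of its \<open>N\<close> unit differences, hence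
  its total influence, uniformly in \<open>N\<close>. Writing the coordinates in binary turns the grid into
  a discrete cube, and Friedgut's argument (hypercontractivity plus an energy bound for the
  high Fourier levels) shows that only the boundedly many coordinates of large influence matter.
\<close>

subsection \<open>Fourier analysis on the discrete cube\<close>

text \<open>Control of oscillation in the sup metric makes single influences small but does not
  directly bound their sum, which could grow with \<open>N\<close>. The way out is that a sum of
  unit differences over a set of coordinates is nearly the effect of moving all of them at once,
  which is a single step for the sup metric. This requires differences that barely vary at unit
  scale, which averaging over boxes of side \<open>N\<close> provides. Such boxes must not change
  the function much, so the grid is refined with \<open>N\<close>. The refinement is harmless: on a
  grid with \<open>n\<close> points per coordinate a unit step costs
  \<open>l = \<eta> / (n * \<kappa>)\<close>, and the estimates involve only
  \<open>6 * l * n = 6 * \<eta> / \<kappa>\<close>, where \<open>\<kappa>\<close> is the least mass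
  attached to a time of the walk, fixed before \<open>N\<close>. The walk supplies a linear order:
  parameters at distance \<open>r\<close> in the interval are at most
  \<open>1 + r / \<kappa>\<close> walk steps apart. The 1 survives at every scale, so the function
  on the grid is Lipschitz only up to an additive \<open>\<eta>\<close>; this is what the
  inf-convolution absorbs.\<close>

definition cube_mean :: "'t set \<Rightarrow> ('t set \<Rightarrow> real) \<Rightarrow> real" where
  "cube_mean T f = (\<Sum>X\<in>Pow T. f X) / 2 ^ card T"

text \<open>With \<open>X\<close> read as the point of \<open>{-1, 1}^T\<close> whose coordinates
  are -1 exactly on \<open>X\<close>, this is the product of the coordinates in \<open>A\<close>.
  The formula is symmetric in \<open>A\<close> and \<open>X\<close>, so points and characters can be
  exchanged.\<close>

definition walsh :: "'t set \<Rightarrow> 't set \<Rightarrow> real" where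
  "walsh A X = (-1) ^ card (A \<inter> X)"

lemma cube_mean_add: "cube_mean T (\<lambda>X. f X + g X) = cube_mean T f + cube_mean T g"
  by (simp add: cube_mean_def sum.distrib add_divide_distrib)

lemma cube_mean_cmult: "cube_mean T (\<lambda>X. c * f X) = c * cube_mean T f"
  by (simp add: cube_mean_def sum_distrib_left)

lemma cube_mean_sum: "cube_mean T (\<lambda>X. \<Sum>a\<in>B. f a X) = (\<Sum>a\<in>B. cube_mean T (f a))"
  unfolding cube_mean_def by (subst sum.swap) (simp add: sum_divide_distrib)

lemma cube_mean_cong: "(\<And>X. X \<subseteq> T \<Longrightarrow> f X = g X) \<Longrightarrow> cube_mean T f = cube_mean T g"
  by (auto simp: cube_mean_def intro!: sum.cong)

lemma cube_mean_mono: "(\<And>X. X \<subseteq> T \<Longrightarrow> f X \<le> g X) \<Longrightarrow> cube_mean T f \<le> cube_mean T g"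
  by (auto simp: cube_mean_def intro!: divide_right_mono sum_mono)

lemma cube_mean_nonneg: "(\<And>X. X \<subseteq> T \<Longrightarrow> 0 \<le> f X) \<Longrightarrow> 0 \<le> cube_mean T f"
  by (auto simp: cube_mean_def intro!: divide_nonneg_nonneg sum_nonneg)

lemma sum_Pow_insert:
  fixes f :: "'t set \<Rightarrow> real"
  assumes "finite T" "t \<notin> T"
  shows "(\<Sum>X\<in>Pow (insert t T). f X) = (\<Sum>X\<in>Pow T. f X + f (insert t X))"
proof -
  have "inj_on (insert t) (Pow T)"
    using assms by (auto simp: inj_on_def)
  moreover have "Pow T \<inter> insert t ` Pow T = {}"
    using assms by auto
  ultimately show ?thesis
    using assms by (simp add: Pow_insert sum.union_disjoint sum.reindex sum.distrib)
qed

lemma cube_mean_insert: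
  assumes "finite T" "t \<notin> T"
  shows "cube_mean (insert t T) f = cube_mean T (\<lambda>X. (f X + f (insert t X)) / 2)"
  using assms by (simp add: cube_mean_def sum_Pow_insert sum_divide_distrib)

lemma cube_mean_Cauchy_Schwarz:
  "(cube_mean T (\<lambda>X. f X * g X))\<^sup>2 \<le> cube_mean T (\<lambda>X. (f X)\<^sup>2) * cube_mean T (\<lambda>X. (g X)\<^sup>2)"
proof -
  have "(\<Sum>X\<in>Pow T. f X * g X)\<^sup>2 \<le> (\<Sum>X\<in>Pow T. (f X)\<^sup>2) * (\<Sum>X\<in>Pow T. (g X)\<^sup>2)"
    by (rule Cauchy_Schwarz_ineq_sum)
  then show ?thesis
    by (simp add: cube_mean_def power_divide divide_right_mono power2_eq_square)
qed

lemma walsh_commute: "walsh A X = walsh X A"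
  by (simp add: walsh_def Int_commute)

lemma walsh_square: "walsh A X * walsh A X = 1"
  by (simp add: walsh_def flip: power_mult_distrib)

lemma walsh_insert_right:
  assumes "finite A" "t \<notin> X"
  shows "walsh A (insert t X) = (if t \<in> A then - walsh A X else walsh A X)"
  using assms by (simp add: walsh_def Int_insert_right)

lemma walsh_insert_left:
  assumes "finite X" "t \<notin> A"
  shows "walsh (insert t A) X = (if t \<in> X then - walsh A X else walsh A X)"
  using walsh_insert_right[OF assms] by (simp add: walsh_commute)

lemma walsh_Un:
  assumes "finite A" "X \<inter> Y = {}"
  shows "walsh A (X \<union> Y) = walsh A X * walsh A Y"
  using assms by (simp add: walsh_def Int_Un_distrib card_Un_disjoint power_add disjoint_iff)

text \<open>If some \<open>t\<close> lies in exactly one of \<open>A\<close> and \<open>B\<close>,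
  the values at \<open>X\<close> and \<open>insert t X\<close> cancel in pairs.\<close>

lemma cube_mean_walsh_product:
  assumes "finite T" "A \<subseteq> T" "B \<subseteq> T"
  shows "cube_mean T (\<lambda>X. walsh A X * walsh B X) = (if A = B then 1 else 0)"
proof (cases "A = B")
  case True
  then show ?thesis
    using assms by (simp add: walsh_square cube_mean_def card_Pow)
next
  case False
  then obtain t where t: "t \<in> T" "t \<in> A \<longleftrightarrow> t \<notin> B"
    using assms by blast
  have fin: "finite A" "finite B"
    using assms finite_subset by auto
  have "cube_mean T (\<lambda>X. walsh A X * walsh B X) =
        cube_mean (insert t (T - {t})) (\<lambda>X. walsh A X * walsh B X)"
    using t by (simp add: insert_absorb)
  also have "\<dots> = cube_mean (T - {t}) (\<lambda>X. 0)"
  proof (subst cube_mean_insert)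
    show "cube_mean (T - {t}) (\<lambda>X. (walsh A X * walsh B X + walsh A (insert t X) * walsh B (insert t X)) / 2)
        = cube_mean (T - {t}) (\<lambda>X. 0)"
    proof (intro cube_mean_cong)
      fix X assume "X \<subseteq> T - {t}"
      then have "t \<notin> X"
        by auto
      then show "(walsh A X * walsh B X + walsh A (insert t X) * walsh B (insert t X)) / 2 = 0"
        using t fin by (auto simp: walsh_insert_right)
    qed
  qed (use assms in auto)
  finally show ?thesis
    using False by (simp add: cube_mean_def)
qed

definition walsh_coeff :: "'t set \<Rightarrow> ('t set \<Rightarrow> real) \<Rightarrow> 't set \<Rightarrow> real" where
  "walsh_coeff T f A = cube_mean T (\<lambda>X. f X * walsh A X)"

text \<open>After the sums are exchanged, the inner sum over \<open>A\<close> is orthogonality with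
  the roles of points and characters swapped; the factor \<open>2 ^ card T\<close> turns that sum
  into a mean.\<close>

lemma walsh_expansion:
  assumes "finite T" "X \<subseteq> T"
  shows "f X = (\<Sum>A\<in>Pow T. walsh_coeff T f A * walsh A X)"
proof -
  have swap: "walsh A Y * walsh A X = walsh Y A * walsh X A" for A Y
    by (simp add: walsh_commute)
  have "(\<Sum>A\<in>Pow T. walsh_coeff T f A * walsh A X) =
        cube_mean T (\<lambda>Y. \<Sum>A\<in>Pow T. f Y * walsh A Y * walsh A X)"
    unfolding cube_mean_sum walsh_coeff_def
    by (intro sum.cong) (auto simp: mult.commute[of _ "walsh _ X"] simp flip: cube_mean_cmult)
  also have "\<dots> = cube_mean T (\<lambda>Y. 2 ^ card T * (f Y * cube_mean T (\<lambda>A. walsh Y A * walsh X A)))"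
    by (intro cube_mean_cong) (simp add: cube_mean_def mult.assoc swap flip: sum_distrib_left)
  also have "\<dots> = cube_mean T (\<lambda>Y. 2 ^ card T * (if Y = X then f X else 0))"
    using assms by (intro cube_mean_cong) (simp add: cube_mean_walsh_product)
  also have "\<dots> = f X"
    using assms by (simp add: cube_mean_def flip: sum_distrib_left)
  finally show ?thesis ..
qed

text \<open>Parseval's identity. It converts the quadratic quantities below into sums over
  coefficients.\<close>

lemma walsh_inner:
  assumes "finite T"
  shows "cube_mean T (\<lambda>X. (\<Sum>A\<in>Pow T. c A * walsh A X) * (\<Sum>A\<in>Pow T. e A * walsh A X))
         = (\<Sum>A\<in>Pow T. c A * e A)"
proof -
  have "cube_mean T (\<lambda>X. (\<Sum>A\<in>Pow T. c A * walsh A X) * (\<Sum>A\<in>Pow T. e A * walsh A X))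
      = (\<Sum>A\<in>Pow T. \<Sum>B\<in>Pow T. cube_mean T (\<lambda>X. c A * e B * (walsh A X * walsh B X)))"
    by (simp add: sum_product cube_mean_sum mult_ac)
  also have "\<dots> = (\<Sum>A\<in>Pow T. \<Sum>B\<in>Pow T. c A * e B * (if A = B then 1 else 0))"
    unfolding cube_mean_cmult
    using assms by (intro sum.cong refl) (simp add: cube_mean_walsh_product)
  also have "\<dots> = (\<Sum>A\<in>Pow T. c A * e A)"
    using assms by (simp add: sum.delta if_distrib cong: if_cong)
  finally show ?thesis .
qed

text \<open>Hypercontractivity from L2 to L4. When a coordinate \<open>t\<close> is split off, the
  polynomial takes the values \<open>q + r\<close> and \<open>q - r\<close>, and the mean of their
  fourth powers has no odd terms: \<open>q^4 + 6 q^2 r^2 + r^4\<close>. The weight 3 per element of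
  \<open>A\<close> is what makes \<open>6 * (Q * R)\<close> the cross term of
  \<open>(Q + 3 * R)^2\<close>.\<close>

lemma Bonami:
  assumes "finite T"
  shows "cube_mean T (\<lambda>X. (\<Sum>A\<in>Pow T. c A * walsh A X) ^ 4)
         \<le> (\<Sum>A\<in>Pow T. 3 ^ card A * (c A)\<^sup>2)\<^sup>2"
  using assms
proof (induction T arbitrary: c rule: finite_induct)
  case empty
  then show ?case
    by (simp add: cube_mean_def walsh_def)
next
  case (insert t T)
  define q where "q X = (\<Sum>A\<in>Pow T. c A * walsh A X)" for X
  define r where "r X = (\<Sum>A\<in>Pow T. c (insert t A) * walsh A X)" for X
  define Q where "Q = (\<Sum>A\<in>Pow T. 3 ^ card A * (c A)\<^sup>2)"
  define R where "R = (\<Sum>A\<in>Pow T. 3 ^ card A * (c (insert t A))\<^sup>2)"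
  have finA: "finite A" "t \<notin> A" if "A \<subseteq> T" for A
    using insert.hyps that finite_subset by blast+
  have Q: "cube_mean T (\<lambda>X. q X ^ 4) \<le> Q\<^sup>2" and R: "cube_mean T (\<lambda>X. r X ^ 4) \<le> R\<^sup>2"
    unfolding q_def r_def Q_def R_def by (rule insert.IH)+
  have Q0: "0 \<le> Q" and R0: "0 \<le> R"
    by (auto simp: Q_def R_def intro!: sum_nonneg)
  have split: "(\<Sum>A\<in>Pow (insert t T). c A * walsh A X) = q X + r X"
              "(\<Sum>A\<in>Pow (insert t T). c A * walsh A (insert t X)) = q X - r X" if "X \<subseteq> T" for X
    using insert.hyps that finA
    by (auto simp: sum_Pow_insert q_def r_def sum.distrib walsh_insert_right walsh_insert_left
             simp flip: sum_subtractf intro!: sum.cong)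
  \<comment> \<open>Cauchy-Schwarz reduces the mixed term to the two fourth moments that the
    induction hypothesis bounds.\<close>
  have "cube_mean T (\<lambda>X. (q X)\<^sup>2 * (r X)\<^sup>2) \<le> Q * R"
  proof (rule power2_le_imp_le)
    have "(cube_mean T (\<lambda>X. (q X)\<^sup>2 * (r X)\<^sup>2))\<^sup>2
        \<le> cube_mean T (\<lambda>X. q X ^ 4) * cube_mean T (\<lambda>X. r X ^ 4)"
      using cube_mean_Cauchy_Schwarz[of T "\<lambda>X. (q X)\<^sup>2" "\<lambda>X. (r X)\<^sup>2"] by simp
    also have "\<dots> \<le> Q\<^sup>2 * R\<^sup>2"
      by (intro mult_mono Q R cube_mean_nonneg) auto
    finally show "(cube_mean T (\<lambda>X. (q X)\<^sup>2 * (r X)\<^sup>2))\<^sup>2 \<le> (Q * R)\<^sup>2"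
      by (simp add: power_mult_distrib)
  qed (use Q0 R0 in simp)
  moreover have "cube_mean (insert t T) (\<lambda>X. (\<Sum>A\<in>Pow (insert t T). c A * walsh A X) ^ 4)
      = cube_mean T (\<lambda>X. q X ^ 4 + 6 * ((q X)\<^sup>2 * (r X)\<^sup>2) + r X ^ 4)"
    unfolding cube_mean_insert[OF insert.hyps]
    by (intro cube_mean_cong) (simp add: split eval_nat_numeral algebra_simps)
  ultimately have "cube_mean (insert t T) (\<lambda>X. (\<Sum>A\<in>Pow (insert t T). c A * walsh A X) ^ 4)
      \<le> Q\<^sup>2 + 6 * (Q * R) + R\<^sup>2"
    using Q R by (simp add: cube_mean_add cube_mean_cmult)
  also have "\<dots> \<le> (Q + 3 * R)\<^sup>2"
    by (simp add: power2_eq_square algebra_simps)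
  also have "Q + 3 * R = (\<Sum>A\<in>Pow (insert t T). 3 ^ card A * (c A)\<^sup>2)"
    using insert.hyps finA
    by (simp add: sum_Pow_insert Q_def R_def sum.distrib sum_distrib_left mult.assoc)
  finally show ?case .
qed

section \<open>Coordinate flips and their Fourier energy\<close>

definition flip_diff :: "('t set \<Rightarrow> real) \<Rightarrow> 't \<Rightarrow> 't set \<Rightarrow> real" where
  "flip_diff f t X = (f X - f (if t \<in> X then X - {t} else insert t X)) / 2"

text \<open>A flip at \<open>t\<close> changes the sign of exactly the characters whose set contains
  \<open>t\<close>. With its factor 1/2, \<open>flip_diff f t\<close> is \<open>f\<close> minus its
  mean over coordinate \<open>t\<close>, so it keeps the coefficients of these sets
  unscaled.\<close>

lemma flip_diff_walsh:
  assumes "finite T" "t \<in> T" "X \<subseteq> T"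
  shows "flip_diff f t X =
    (\<Sum>A\<in>Pow T. (if t \<in> A then walsh_coeff T f A else 0) * walsh A X)"
proof -
  have *: "walsh A (if t \<in> X then X - {t} else insert t X) = (if t \<in> A then -1 else 1) * walsh A X"
    if "A \<subseteq> T" for A
    using walsh_insert_right[of A t X] walsh_insert_right[of A t "X - {t}"]
      finite_subset[OF that assms(1)]
    by (auto simp: insert_absorb)
  have "(if t \<in> X then X - {t} else insert t X) \<subseteq> T"
    using assms by auto
  then have "flip_diff f t X = (\<Sum>A\<in>Pow T. walsh_coeff T f A * walsh A X
          - walsh_coeff T f A * walsh A (if t \<in> X then X - {t} else insert t X)) / 2"
    unfolding flip_diff_def sum_subtractf
    using walsh_expansion[OF assms(1,3), of f] walsh_expansion[OF assms(1)] by metis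
  also have "\<dots> = (\<Sum>A\<in>Pow T. (if t \<in> A then walsh_coeff T f A else 0) * walsh A X)"
    unfolding sum_divide_distrib by (intro sum.cong) (auto simp: *)
  finally show ?thesis .
qed

text \<open>Summed over \<open>t\<close>, each squared coefficient is counted \<open>card A\<close>
  times; this is how the total energy penalises high degree.\<close>

lemma walsh_flip_energy:
  assumes "finite T" "t \<in> T"
  shows "cube_mean T (\<lambda>X. (flip_diff f t X)\<^sup>2) = (\<Sum>A\<in>{A\<in>Pow T. t \<in> A}. (walsh_coeff T f A)\<^sup>2)"
proof -
  have "cube_mean T (\<lambda>X. (flip_diff f t X)\<^sup>2)
      = (\<Sum>A\<in>Pow T. (if t \<in> A then walsh_coeff T f A else 0) * (if t \<in> A then walsh_coeff T f A else 0))"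
    by (subst walsh_inner[OF assms(1), symmetric], intro cube_mean_cong) (simp add: flip_diff_walsh[OF assms] power2_eq_square)
  also have "\<dots> = (\<Sum>A\<in>Pow T. if t \<in> A then (walsh_coeff T f A)\<^sup>2 else 0)"
    by (intro sum.cong) (auto simp: power2_eq_square)
  finally show ?thesis
    using assms by (simp only: sum.inter_filter finite_Pow_iff)
qed

text \<open>Duality with \<open>Bonami\<close>: the low-degree part \<open>p\<close> of \<open>h = flip_diff f t\<close> satisfies
  \<open>\<parallel>p\<parallel>\<^sub>2\<^sup>2 = \<langle>h, p\<rangle>\<close>, and two applications of Cauchy--Schwarz replace Hoelder's inequality
  with exponents \<open>4/3\<close> and \<open>4\<close>.\<close>

lemma low_degree_energy:
  assumes "finite T" "t \<in> T"
  shows "(\<Sum>A\<in>{A\<in>Pow T. t \<in> A \<and> card A \<le> d}. (walsh_coeff T f A)\<^sup>2)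
    \<le> 3 ^ d * cube_mean T (\<lambda>X. \<bar>flip_diff f t X\<bar>) * sqrt (cube_mean T (\<lambda>X. (flip_diff f t X)\<^sup>2))"
proof -
  define h where "h = flip_diff f t"
  define c where "c A = (if t \<in> A \<and> card A \<le> d then walsh_coeff T f A else 0)" for A
  define p where "p X = (\<Sum>A\<in>Pow T. c A * walsh A X)" for X
  define s where "s = (\<Sum>A\<in>{A\<in>Pow T. t \<in> A \<and> card A \<le> d}. (walsh_coeff T f A)\<^sup>2)"
  have s: "s = (\<Sum>A\<in>Pow T. (c A)\<^sup>2)"
    unfolding s_def using assms
    by (subst sum.inter_filter) (auto simp: c_def intro!: sum.cong)
  have s0: "0 \<le> s"
    unfolding s_def by (intro sum_nonneg) auto
  have E0: "0 \<le> cube_mean T (\<lambda>X. \<bar>h X\<bar>)" "0 \<le> cube_mean T (\<lambda>X. (h X)\<^sup>2)"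
    by (auto intro!: cube_mean_nonneg)
  have "cube_mean T (\<lambda>X. p X ^ 4) \<le> (\<Sum>A\<in>Pow T. 3 ^ card A * (c A)\<^sup>2)\<^sup>2"
    unfolding p_def by (rule Bonami[OF assms(1)])
  also have "(\<Sum>A\<in>Pow T. 3 ^ card A * (c A)\<^sup>2)\<^sup>2 \<le> (3 ^ d * s)\<^sup>2"
  proof (intro power_mono sum_nonneg)
    show "(\<Sum>A\<in>Pow T. 3 ^ card A * (c A)\<^sup>2) \<le> 3 ^ d * s"
      unfolding s sum_distrib_left
      by (intro sum_mono) (auto simp: c_def intro!: mult_right_mono)
  qed auto
  finally have p4: "cube_mean T (\<lambda>X. p X ^ 4) \<le> (3 ^ d * s)\<^sup>2" .
  have "s = cube_mean T (\<lambda>X. h X * p X)"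
  proof -
    have "cube_mean T (\<lambda>X. h X * p X) = (\<Sum>A\<in>Pow T. (if t \<in> A then walsh_coeff T f A else 0) * c A)"
      unfolding h_def p_def
      by (subst walsh_inner[OF assms(1), symmetric], intro cube_mean_cong) (simp add: flip_diff_walsh[OF assms])
    also have "\<dots> = s"
      unfolding s by (intro sum.cong) (auto simp: c_def power2_eq_square)
    finally show ?thesis ..
  qed
  \<comment> \<open>Splitting the weight into two square roots lets the first Cauchy-Schwarz isolate
    the L1 norm of \<open>h\<close>, the quantity that is small for an uninfluential coordinate; the
    other factor keeps the weight \<open>\<bar>h X\<bar>\<close> for the second application.\<close>
  also have "\<dots> \<le> cube_mean T (\<lambda>X. sqrt \<bar>h X\<bar> * (sqrt \<bar>h X\<bar> * \<bar>p X\<bar>))"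
    by (intro cube_mean_mono) (simp add: mult.assoc[symmetric] flip: abs_mult)
  finally have "s\<^sup>2 \<le> (cube_mean T (\<lambda>X. sqrt \<bar>h X\<bar> * (sqrt \<bar>h X\<bar> * \<bar>p X\<bar>)))\<^sup>2"
    using s0 by (intro power_mono)
  also have "\<dots> \<le> cube_mean T (\<lambda>X. (sqrt \<bar>h X\<bar>)\<^sup>2) * cube_mean T (\<lambda>X. (sqrt \<bar>h X\<bar> * \<bar>p X\<bar>)\<^sup>2)"
    by (rule cube_mean_Cauchy_Schwarz)
  also have "\<dots> = cube_mean T (\<lambda>X. \<bar>h X\<bar>) * cube_mean T (\<lambda>X. \<bar>h X\<bar> * (p X)\<^sup>2)"
    by (simp add: power_mult_distrib)
  also have "\<dots> \<le> cube_mean T (\<lambda>X. \<bar>h X\<bar>) * (sqrt (cube_mean T (\<lambda>X. (h X)\<^sup>2)) * (3 ^ d * s))"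
  proof (rule mult_left_mono[OF _ E0(1)], rule power2_le_imp_le)
    have "(cube_mean T (\<lambda>X. \<bar>h X\<bar> * (p X)\<^sup>2))\<^sup>2
        \<le> cube_mean T (\<lambda>X. (h X)\<^sup>2) * cube_mean T (\<lambda>X. p X ^ 4)"
      using cube_mean_Cauchy_Schwarz[of T "\<lambda>X. \<bar>h X\<bar>" "\<lambda>X. (p X)\<^sup>2"] by simp
    also have "\<dots> \<le> cube_mean T (\<lambda>X. (h X)\<^sup>2) * (3 ^ d * s)\<^sup>2"
      by (intro mult_left_mono p4 E0)
    finally show "(cube_mean T (\<lambda>X. \<bar>h X\<bar> * (p X)\<^sup>2))\<^sup>2
        \<le> (sqrt (cube_mean T (\<lambda>X. (h X)\<^sup>2)) * (3 ^ d * s))\<^sup>2"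
      using E0 by (simp add: power_mult_distrib)
  qed (use E0 s0 in simp)
  finally have "s * s \<le> (3 ^ d * cube_mean T (\<lambda>X. \<bar>h X\<bar>) * sqrt (cube_mean T (\<lambda>X. (h X)\<^sup>2))) * s"
    by (simp add: power2_eq_square mult_ac)
  \<comment> \<open>One factor \<open>s\<close> cancels; if \<open>s = 0\<close>, the bound is just
    nonnegativity of the right-hand side.\<close>
  then have "s \<le> 3 ^ d * cube_mean T (\<lambda>X. \<bar>h X\<bar>) * sqrt (cube_mean T (\<lambda>X. (h X)\<^sup>2))"
    using s0 E0 by (cases "s = 0") (auto simp: mult_le_cancel_right)
  then show ?thesis
    unfolding s_def h_def .
qed

section \<open>Averaging out coordinates and Friedgut's inequality\<close>

definition cube_average_out :: "'t set \<Rightarrow> ('t set \<Rightarrow> real) \<Rightarrow> 't set \<Rightarrow> real" where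
  "cube_average_out R f X = cube_mean R (\<lambda>Y. f ((X - R) \<union> Y))"

text \<open>Averaging over \<open>R\<close> kills every character whose set meets \<open>R\<close>
  and fixes the others, so it is the Fourier projection onto the sets disjoint from
  \<open>R\<close>.\<close>

lemma cube_average_out_walsh:
  assumes "finite T" "R \<subseteq> T" "X \<subseteq> T"
  shows "cube_average_out R f X =
    (\<Sum>A\<in>Pow T. (if A \<inter> R = {} then walsh_coeff T f A else 0) * walsh A X)"
proof -
  have finR: "finite R"
    using assms finite_subset by auto
  have *: "cube_mean R (\<lambda>Y. walsh A ((X - R) \<union> Y)) = (if A \<inter> R = {} then walsh A X else 0)"
    if A: "A \<subseteq> T" for A
  proof -
    have finA: "finite A"
      using finite_subset[OF A assms(1)] .
    have "cube_mean R (\<lambda>Y. walsh A ((X - R) \<union> Y))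
        = cube_mean R (\<lambda>Y. walsh A (X - R) * (walsh (A \<inter> R) Y * walsh {} Y))"
      by (intro cube_mean_cong, subst walsh_Un[OF finA])
         (auto simp: walsh_def inf_absorb2 Int_assoc)
    also have "\<dots> = (if A \<inter> R = {} then walsh A (X - R) else 0)"
      unfolding cube_mean_cmult using finR by (simp add: cube_mean_walsh_product)
    also have "\<dots> = (if A \<inter> R = {} then walsh A X else 0)"
      by (auto simp: walsh_def intro!: arg_cong[where f = "\<lambda>B. (-1) ^ card B"])
    finally show ?thesis .
  qed
  have "cube_average_out R f X
      = cube_mean R (\<lambda>Y. \<Sum>A\<in>Pow T. walsh_coeff T f A * walsh A ((X - R) \<union> Y))"
    unfolding cube_average_out_def
    using assms by (intro cube_mean_cong walsh_expansion) auto
  also have "\<dots> = (\<Sum>A\<in>Pow T. walsh_coeff T f A * (if A \<inter> R = {} then walsh A X else 0))"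
    unfolding cube_mean_sum cube_mean_cmult by (intro sum.cong) (auto simp: *)
  also have "\<dots> = (\<Sum>A\<in>Pow T. (if A \<inter> R = {} then walsh_coeff T f A else 0) * walsh A X)"
    by (intro sum.cong) auto
  finally show ?thesis .
qed

text \<open>The Fourier mass outside the juntas on \<open>T - R\<close> is split at degree \<open>d\<close>: the high-degree
  part is controlled by the total energy, the low-degree part by hypercontractivity.\<close>

lemma Friedgut_inequality:
  assumes "finite T" "R \<subseteq> T"
  shows "cube_mean T (\<lambda>X. (f X - cube_average_out R f X)\<^sup>2)
    \<le> (\<Sum>t\<in>T. cube_mean T (\<lambda>X. (flip_diff f t X)\<^sup>2)) / (d + 1)
      + 3 ^ d * (\<Sum>t\<in>R. cube_mean T (\<lambda>X. \<bar>flip_diff f t X\<bar>)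
                        * sqrt (cube_mean T (\<lambda>X. (flip_diff f t X)\<^sup>2)))"
proof -
  define c where "c = walsh_coeff T f"
  have finR: "finite R"
    using assms finite_subset by auto
  have swap: "(\<Sum>A\<in>Pow T. \<Sum>t\<in>B. if P t A then (c A)\<^sup>2 else 0)
      = (\<Sum>t\<in>B. \<Sum>A\<in>{A\<in>Pow T. P t A}. (c A)\<^sup>2)" for B P
    by (subst sum.swap) (simp only: sum.inter_filter finite_Pow_iff assms(1))
  have "cube_mean T (\<lambda>X. (f X - cube_average_out R f X)\<^sup>2)
      = (\<Sum>A\<in>Pow T. (if A \<inter> R = {} then 0 else c A) * (if A \<inter> R = {} then 0 else c A))"
  proof (subst walsh_inner[OF assms(1), symmetric], intro cube_mean_cong)
    fix X assume X: "X \<subseteq> T"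
    have "f X - cube_average_out R f X = (\<Sum>A\<in>Pow T. (if A \<inter> R = {} then 0 else c A) * walsh A X)"
      unfolding cube_average_out_walsh[OF assms X] walsh_expansion[OF assms(1) X, of f] c_def
        sum_subtractf[symmetric] by (intro sum.cong) auto
    then show "(f X - cube_average_out R f X)\<^sup>2 =
        (\<Sum>A\<in>Pow T. (if A \<inter> R = {} then 0 else c A) * walsh A X) *
        (\<Sum>A\<in>Pow T. (if A \<inter> R = {} then 0 else c A) * walsh A X)"
      by (simp add: power2_eq_square)
  qed
  also have "\<dots> \<le> (\<Sum>A\<in>Pow T. real (card A) * (c A)\<^sup>2 / (d + 1)
        + (\<Sum>t\<in>R. if t \<in> A \<and> card A \<le> d then (c A)\<^sup>2 else 0))"
  proof (intro sum_mono)
    fix A assume "A \<in> Pow T"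
    \<comment> \<open>A set that meets \<open>R\<close> either has degree above \<open>d\<close>,
      where \<open>card A / (d + 1)\<close> is at least 1, or is counted by at least one
      \<open>t\<close> in \<open>R\<close>.\<close>
    consider "A \<inter> R = {}" | "d < card A" | t where "t \<in> A" "t \<in> R" "card A \<le> d"
      using linorder_not_less by blast
    then show "(if A \<inter> R = {} then 0 else c A) * (if A \<inter> R = {} then 0 else c A)
      \<le> real (card A) * (c A)\<^sup>2 / (d + 1) + (\<Sum>t\<in>R. if t \<in> A \<and> card A \<le> d then (c A)\<^sup>2 else 0)"
    proof cases
      case 1
      then show ?thesis by (auto intro!: add_nonneg_nonneg sum_nonneg)
    next
      case 2
      then have "(c A)\<^sup>2 * (d + 1) \<le> (c A)\<^sup>2 * real (card A)"
        by (intro mult_left_mono) auto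
      then have "(c A)\<^sup>2 \<le> real (card A) * (c A)\<^sup>2 / (d + 1)"
        by (simp add: field_simps)
      moreover have "0 \<le> (\<Sum>t\<in>R. if t \<in> A \<and> card A \<le> d then (c A)\<^sup>2 else 0)"
        by (intro sum_nonneg) auto
      ultimately show ?thesis
        by (auto simp: power2_eq_square)
    next
      case 3
      have "(if t \<in> A \<and> card A \<le> d then (c A)\<^sup>2 else 0)
          \<le> (\<Sum>t\<in>R. if t \<in> A \<and> card A \<le> d then (c A)\<^sup>2 else 0)"
        using 3 finR by (intro member_le_sum) auto
      moreover have "0 \<le> real (card A) * (c A)\<^sup>2 / (d + 1)"
        by simp
      moreover have "(if A \<inter> R = {} then 0 else c A) * (if A \<inter> R = {} then 0 else c A)
          = (if t \<in> A \<and> card A \<le> d then (c A)\<^sup>2 else 0)"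
        using 3 by (auto simp: power2_eq_square)
      ultimately show ?thesis
        by linarith
    qed
  qed
  also have "\<dots> = (\<Sum>A\<in>Pow T. real (card A) * (c A)\<^sup>2) / (d + 1)
        + (\<Sum>t\<in>R. \<Sum>A\<in>{A\<in>Pow T. t \<in> A \<and> card A \<le> d}. (c A)\<^sup>2)"
    by (simp only: sum.distrib sum_divide_distrib swap)
  also have "(\<Sum>A\<in>Pow T. real (card A) * (c A)\<^sup>2)
      = (\<Sum>A\<in>Pow T. \<Sum>t\<in>T. if t \<in> A then (c A)\<^sup>2 else 0)"
  proof (intro sum.cong refl)
    fix A assume "A \<in> Pow T"
    then have "{t \<in> T. t \<in> A} = A"
      by auto
    then show "real (card A) * (c A)\<^sup>2 = (\<Sum>t\<in>T. if t \<in> A then (c A)\<^sup>2 else 0)"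
      using assms(1) by (simp flip: sum.inter_filter)
  qed
  also have "\<dots> = (\<Sum>t\<in>T. \<Sum>A\<in>{A\<in>Pow T. t \<in> A}. (c A)\<^sup>2)"
    by (rule swap)
  also have "(\<Sum>t\<in>T. \<Sum>A\<in>{A\<in>Pow T. t \<in> A}. (c A)\<^sup>2) = (\<Sum>t\<in>T. cube_mean T (\<lambda>X. (flip_diff f t X)\<^sup>2))"
    unfolding c_def using assms by (simp add: walsh_flip_energy)
  also have "(\<Sum>t\<in>R. \<Sum>A\<in>{A\<in>Pow T. t \<in> A \<and> card A \<le> d}. (c A)\<^sup>2)
     \<le> 3 ^ d * (\<Sum>t\<in>R. cube_mean T (\<lambda>X. \<bar>flip_diff f t X\<bar>)
                        * sqrt (cube_mean T (\<lambda>X. (flip_diff f t X)\<^sup>2)))"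
    unfolding c_def sum_distrib_left mult.assoc[symmetric]
    using assms by (intro sum_mono low_degree_energy) auto
  finally show ?thesis by (simp add: add.commute)
qed

subsection \<open>Juntas on dyadic grids\<close>

definition grid_mean :: "'i set \<Rightarrow> nat \<Rightarrow> (('i \<Rightarrow> nat) \<Rightarrow> real) \<Rightarrow> real" where
  "grid_mean I n f = (\<Sum>x\<in>PiE I (\<lambda>_. {..<n}). f x) / real n ^ card I"

definition bit_enc :: "'i set \<Rightarrow> ('i \<times> nat) set \<Rightarrow> 'i \<Rightarrow> nat" where
  "bit_enc I X = (\<lambda>i\<in>I. set_encode {j. (i, j) \<in> X})"

section \<open>Binary encoding of the grid\<close>

lemma set_encode_less:
  assumes "A \<subseteq> {..<M}"
  shows "set_encode A < 2 ^ M"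
proof -
  have "set_encode A \<le> (\<Sum>j<M. 2 ^ j)"
    unfolding set_encode_def using assms by (intro sum_mono2) auto
  also have "\<dots> < 2 ^ M"
    by (induction M) auto
  finally show ?thesis .
qed

text \<open>Finite sets are determined by their binary codes, which gives injectivity; surjectivity
  follows by counting, since cube and grid have equally many points. Uniform means on the two sides
  therefore agree.\<close>

lemma bij_betw_bit_enc:
  assumes "finite I"
  shows "bij_betw (bit_enc I) (Pow (I \<times> {..<M})) (PiE I (\<lambda>_. {..<2 ^ M}))"
proof -
  have fibre: "{j. (i, j) \<in> X} \<subseteq> {..<M}" if "X \<subseteq> I \<times> {..<M}" for i X
    using that by auto
  have "inj_on (bit_enc I) (Pow (I \<times> {..<M}))"
  proof (rule inj_onI)
    fix X Y assume X: "X \<in> Pow (I \<times> {..<M})" and Y: "Y \<in> Pow (I \<times> {..<M})"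
      and eq: "bit_enc I X = bit_enc I Y"
    have "{j. (i, j) \<in> X} = {j. (i, j) \<in> Y}" if "i \<in> I" for i
    proof -
      have "finite {j. (i, j) \<in> X}" "finite {j. (i, j) \<in> Y}"
        using fibre[of X i] fibre[of Y i] X Y finite_subset by blast+
      then show ?thesis
        using fun_cong[OF eq, of i] that by (simp add: bit_enc_def set_encode_eq)
    qed
    then show "X = Y"
      using X Y by auto
  qed
  moreover have "bit_enc I ` Pow (I \<times> {..<M}) \<subseteq> PiE I (\<lambda>_. {..<2 ^ M})"
    using fibre by (auto simp: bit_enc_def intro!: set_encode_less)
  moreover have "card (Pow (I \<times> {..<M})) = card (PiE I (\<lambda>_. {..<2 ^ M :: nat}))"
    using assms by (simp add: card_Pow card_PiE card_cartesian_product power_mult mult.commute)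
  ultimately show ?thesis
    using assms by (metis bij_betw_def card_image card_subset_eq finite_PiE finite_lessThan)
qed

lemma cube_mean_bit_enc:
  assumes "finite I"
  shows "cube_mean (I \<times> {..<M}) (\<lambda>X. h (bit_enc I X)) = grid_mean I (2 ^ M) h"
  unfolding cube_mean_def grid_mean_def
  using sum.reindex_bij_betw[OF bij_betw_bit_enc[OF assms], of h M]
  by (simp add: card_cartesian_product power_mult mult.commute)

text \<open>No carry occurs because bit \<open>j\<close> was off. A bit flip is thereby a run of
  \<open>2 ^ j\<close> unit steps of a single grid coordinate.\<close>

lemma bit_enc_insert:
  assumes "finite X" "(i, j) \<notin> X" "i \<in> I"
  shows "bit_enc I (insert (i, j) X) = (bit_enc I X)(i := bit_enc I X i + 2 ^ j)"
proof -
  have "finite {k. (i, k) \<in> X}"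
    using finite_imageI[OF assms(1), of snd] by (rule rev_finite_subset) force
  moreover have "{k. (i, k) \<in> insert (i, j) X} = insert j {k. (i, k) \<in> X}"
    by auto
  ultimately show ?thesis
    using assms by (auto simp: bit_enc_def fun_eq_iff)
qed

text \<open>All bits of a coordinate are averaged out together, so that the juntas found on the cube
  depend on whole grid coordinates.\<close>

lemma cube_average_out_bit_enc:
  assumes "finite I" "J \<subseteq> I" "X \<subseteq> I \<times> {..<M}"
  shows "cube_average_out (J \<times> {..<M}) (\<lambda>X. G (bit_enc I X)) X
    = grid_mean J (2 ^ M) (\<lambda>y. G (\<lambda>i. if i \<in> J then y i else bit_enc I X i))"
proof -
  have "bit_enc I ((X - J \<times> {..<M}) \<union> Y) = (\<lambda>i. if i \<in> J then bit_enc J Y i else bit_enc I X i)"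
    if "Y \<subseteq> J \<times> {..<M}" for Y
  proof
    fix i
    have "{j. (i, j) \<in> (X - J \<times> {..<M}) \<union> Y} = (if i \<in> J then {j. (i, j) \<in> Y} else {j. (i, j) \<in> X})"
      using that assms(3) by auto
    then show "bit_enc I ((X - J \<times> {..<M}) \<union> Y) i = (if i \<in> J then bit_enc J Y i else bit_enc I X i)"
      using assms(2) by (auto simp: bit_enc_def)
  qed
  then have "cube_average_out (J \<times> {..<M}) (\<lambda>X. G (bit_enc I X)) X
    = cube_mean (J \<times> {..<M}) (\<lambda>Y. G (\<lambda>i. if i \<in> J then bit_enc J Y i else bit_enc I X i))"
    unfolding cube_average_out_def by (intro cube_mean_cong) simp
  then show ?thesis
    using cube_mean_bit_enc[of J M "\<lambda>y. G (\<lambda>i. if i \<in> J then y i else bit_enc I X i)"]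
      assms finite_subset by auto
qed

lemma grid_mean_sum: "grid_mean I n (\<lambda>x. \<Sum>a\<in>B. f a x) = (\<Sum>a\<in>B. grid_mean I n (f a))"
  unfolding grid_mean_def by (subst sum.swap) (simp add: sum_divide_distrib)

lemma grid_mean_nonneg: "(\<And>x. 0 \<le> f x) \<Longrightarrow> 0 \<le> grid_mean I n f"
  by (auto simp: grid_mean_def intro!: divide_nonneg_nonneg sum_nonneg)

lemma grid_mean_le:
  assumes "finite I" "n > 0" "\<And>x. x \<in> PiE I (\<lambda>_. {..<n}) \<Longrightarrow> f x \<le> c"
  shows "grid_mean I n f \<le> c"
proof -
  have "(\<Sum>x\<in>PiE I (\<lambda>_. {..<n}). f x) \<le> real (card (PiE I (\<lambda>_. {..<n}))) * c"
    using assms(3) by (intro sum_bounded_above)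
  then show ?thesis
    using assms by (simp add: grid_mean_def card_PiE field_simps)
qed

section \<open>Bit flips as runs of unit steps\<close>

context
  fixes I :: "'i set" and M :: nat and G :: "('i \<Rightarrow> nat) \<Rightarrow> real" and K :: real
  assumes finI: "finite I"
    and steps: "\<And>x. x \<in> PiE I (\<lambda>_. {..<2 ^ M}) \<Longrightarrow> (\<Sum>i\<in>I. \<bar>G (x(i := Suc (x i))) - G x\<bar>) \<le> K"
begin

text \<open>The difference telescopes along the \<open>2 ^ j\<close> unit steps that realise the
  flip; the 1/2 comes from \<open>flip_diff\<close>. The intermediate points stay in the grid
  because the end point, with bit \<open>j\<close> switched on, lies in it. The assumption
  \<open>steps\<close> also covers forward steps that leave the grid at its boundary, which is why
  \<open>G\<close> lives on all functions.\<close>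

lemma flip_diff_le_steps:
  assumes ij: "i \<in> I" "j < M" and X: "X \<subseteq> I \<times> {..<M} - {(i, j)}"
  defines "u \<equiv> \<Sum>r<(2::nat) ^ j. \<bar>G ((bit_enc I X)(i := Suc (bit_enc I X i + r)))
                      - G ((bit_enc I X)(i := bit_enc I X i + r))\<bar>"
  shows "\<bar>flip_diff (\<lambda>X. G (bit_enc I X)) (i, j) X\<bar> \<le> u / 2"
    and "\<bar>flip_diff (\<lambda>X. G (bit_enc I X)) (i, j) (insert (i, j) X)\<bar> \<le> u / 2"
    and "r < 2 ^ j \<Longrightarrow> (bit_enc I X)(i := bit_enc I X i + r) \<in> PiE I (\<lambda>_. {..<2 ^ M})"
proof -
  have ijX: "(i, j) \<notin> X"
    using X by auto
  have finX: "finite X"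
    using X finI finite_subset by (metis finite_Diff finite_cartesian_product finite_lessThan)
  note ins = bit_enc_insert[OF finX ijX ij(1)]
  define y where "y r = (bit_enc I X)(i := bit_enc I X i + r)" for r
  have "G (y (2 ^ j)) - G (y 0) = (\<Sum>r<(2::nat) ^ j. G (y (Suc r)) - G (y r))"
    by (rule sum_lessThan_telescope[symmetric])
  then have u: "\<bar>G (y (2 ^ j)) - G (y 0)\<bar> \<le> u"
    unfolding u_def y_def using sum_abs[of "\<lambda>r. G (y (Suc r)) - G (y r)" "{..<2 ^ j}"]
    by (simp add: y_def)
  have y: "y (2 ^ j) = bit_enc I (insert (i, j) X)" "y 0 = bit_enc I X"
    unfolding ins by (simp_all add: y_def)
  show "\<bar>flip_diff (\<lambda>X. G (bit_enc I X)) (i, j) X\<bar> \<le> u / 2"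
    and "\<bar>flip_diff (\<lambda>X. G (bit_enc I X)) (i, j) (insert (i, j) X)\<bar> \<le> u / 2"
    using u ijX unfolding y flip_diff_def by auto
  assume r: "r < 2 ^ j"
  have "X \<in> Pow (I \<times> {..<M})" "insert (i, j) X \<in> Pow (I \<times> {..<M})"
    using X ij by auto
  then have grid: "bit_enc I X \<in> PiE I (\<lambda>_. {..<2 ^ M})"
      "bit_enc I (insert (i, j) X) \<in> PiE I (\<lambda>_. {..<2 ^ M})"
    using bij_betwE[OF bij_betw_bit_enc[OF finI, of M]] by (simp_all only: Ball_def)
  moreover have "bit_enc I X i + 2 ^ j < 2 ^ M"
    using PiE_mem[OF grid(2) ij(1)] unfolding ins by simp
  ultimately show "(bit_enc I X)(i := bit_enc I X i + r) \<in> PiE I (\<lambda>_. {..<2 ^ M})"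
    using r ij(1) by (auto simp: PiE_def extensional_def)
qed

text \<open>Each unit difference is one term of a sum that is at most \<open>K\<close>. The bound
  serves to estimate mean squares by a supremum times a mean.\<close>

lemma flip_diff_sup:
  assumes ij: "i \<in> I" "j < M" and X: "X \<subseteq> I \<times> {..<M}"
  shows "\<bar>flip_diff (\<lambda>X. G (bit_enc I X)) (i, j) X\<bar> \<le> 2 ^ j * K"
proof -
  define Y where "Y = X - {(i, j)}"
  have Y: "Y \<subseteq> I \<times> {..<M} - {(i, j)}"
    using X by (auto simp: Y_def)
  define u where "u = (\<Sum>r<(2::nat) ^ j. \<bar>G ((bit_enc I Y)(i := Suc (bit_enc I Y i + r)))
                      - G ((bit_enc I Y)(i := bit_enc I Y i + r))\<bar>)"
  have "u \<le> (\<Sum>r<(2::nat) ^ j. K)"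
    unfolding u_def
  proof (intro sum_mono)
    fix r :: nat assume "r \<in> {..<2 ^ j}"
    then have y: "(bit_enc I Y)(i := bit_enc I Y i + r) \<in> PiE I (\<lambda>_. {..<2 ^ M})" (is "?y \<in> _")
      using flip_diff_le_steps(3)[OF ij Y] by auto
    have "\<bar>G (?y(i := Suc (?y i))) - G ?y\<bar> \<le> (\<Sum>i\<in>I. \<bar>G (?y(i := Suc (?y i))) - G ?y\<bar>)"
      using ij finI by (intro member_le_sum) auto
    also have "\<dots> \<le> K"
      by (rule steps[OF y])
    finally show "\<bar>G ((bit_enc I Y)(i := Suc (bit_enc I Y i + r)))
                      - G ((bit_enc I Y)(i := bit_enc I Y i + r))\<bar> \<le> K"
      by simp
  qed
  moreover have "\<bar>flip_diff (\<lambda>X. G (bit_enc I X)) (i, j) X\<bar> \<le> u / 2"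
    using flip_diff_le_steps(1,2)[OF ij Y] unfolding u_def Y_def
    by (cases "(i, j) \<in> X") (auto simp: insert_absorb)
  moreover have "0 \<le> u"
    unfolding u_def by (intro sum_nonneg) auto
  ultimately show ?thesis
    by simp
qed

text \<open>For a fixed offset \<open>r\<close> the shifted points are distinct points of the grid,
  so their contribution is at most the sum over the whole grid; there are \<open>2 ^ j\<close>
  offsets.\<close>

lemma flip_diff_mean:
  assumes ij: "i \<in> I" "j < M"
  shows "cube_mean (I \<times> {..<M}) (\<lambda>X. \<bar>flip_diff (\<lambda>X. G (bit_enc I X)) (i, j) X\<bar>)
    \<le> 2 ^ j * grid_mean I (2 ^ M) (\<lambda>x. \<bar>G (x(i := Suc (x i))) - G x\<bar>)"
proof -
  define T where "T = I \<times> {..<M} - {(i, j)}"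
  define e where "e x = \<bar>G (x(i := Suc (x i))) - G x\<bar>" for x
  define sh where "sh r X = (bit_enc I X)(i := bit_enc I X i + r)" for r X
  have T: "finite T" "(i, j) \<notin> T" "I \<times> {..<M} = insert (i, j) T"
    using ij finI by (auto simp: T_def)
  have "cube_mean (I \<times> {..<M}) (\<lambda>X. \<bar>flip_diff (\<lambda>X. G (bit_enc I X)) (i, j) X\<bar>)
      \<le> cube_mean T (\<lambda>X. \<Sum>r<(2::nat) ^ j. e (sh r X) / 2)"
    unfolding T(3) cube_mean_insert[OF T(1,2)]
  proof (intro cube_mean_mono)
    fix X assume "X \<subseteq> T"
    then have X: "X \<subseteq> I \<times> {..<M} - {(i, j)}"
      by (simp add: T_def)
    show "(\<bar>flip_diff (\<lambda>X. G (bit_enc I X)) (i, j) X\<bar>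
        + \<bar>flip_diff (\<lambda>X. G (bit_enc I X)) (i, j) (insert (i, j) X)\<bar>) / 2 \<le> (\<Sum>r<(2::nat) ^ j. e (sh r X) / 2)"
      using flip_diff_le_steps(1,2)[OF ij X] by (simp add: e_def sh_def flip: sum_divide_distrib)
  qed
  also have "\<dots> = (\<Sum>r<(2::nat) ^ j. (\<Sum>X\<in>Pow T. e (sh r X)) / (2 * 2 ^ card T))"
    unfolding cube_mean_sum by (simp add: cube_mean_def sum_divide_distrib)
  also have "\<dots> \<le> (\<Sum>r<(2::nat) ^ j. (\<Sum>x\<in>PiE I (\<lambda>_. {..<2 ^ M}). e x) / (2 * 2 ^ card T))"
  proof (intro sum_mono divide_right_mono)
    fix r :: nat assume r: "r \<in> {..<2 ^ j}"
    have "inj_on (sh r) (Pow T)"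
    proof (rule inj_onI)
      fix X Y assume XY: "X \<in> Pow T" "Y \<in> Pow T" "sh r X = sh r Y"
      have "bit_enc I X = bit_enc I Y"
      proof
        fix k show "bit_enc I X k = bit_enc I Y k"
          using fun_cong[OF XY(3), of k] by (simp add: sh_def split: if_splits)
      qed
      moreover have "X \<in> Pow (I \<times> {..<M})" "Y \<in> Pow (I \<times> {..<M})"
        using XY by (auto simp: T_def)
      ultimately show "X = Y"
        using bij_betw_imp_inj_on[OF bij_betw_bit_enc[OF finI, of M]] by (auto dest: inj_onD)
    qed
    then have "(\<Sum>X\<in>Pow T. e (sh r X)) = (\<Sum>x\<in>sh r ` Pow T. e x)"
      by (simp add: sum.reindex)
    also have "\<dots> \<le> (\<Sum>x\<in>PiE I (\<lambda>_. {..<2 ^ M}). e x)"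
    proof (rule sum_mono2)
      show "finite (PiE I (\<lambda>_. {..<2 ^ M :: nat}))"
        using finI by (simp add: finite_PiE)
      show "sh r ` Pow T \<subseteq> PiE I (\<lambda>_. {..<2 ^ M})"
        using flip_diff_le_steps(3)[OF ij] r by (auto simp: sh_def T_def)
    qed (simp add: e_def)
    finally show "(\<Sum>X\<in>Pow T. e (sh r X)) \<le> (\<Sum>x\<in>PiE I (\<lambda>_. {..<2 ^ M}). e x)" .
  qed simp
  also have "\<dots> = 2 ^ j * grid_mean I (2 ^ M) e"
  proof -
    \<comment> \<open>The extra factor 2 accounts for the bit \<open>(i, j)\<close> that
      \<open>T\<close> omits.\<close>
    have "(2 :: real) * 2 ^ card T = 2 ^ card (insert (i, j) T)"
      using T by simp
    also have "\<dots> = real (2 ^ M) ^ card I"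
      by (simp add: T(3)[symmetric] card_cartesian_product power_mult mult.commute)
    finally show ?thesis
      by (simp add: grid_mean_def)
  qed
  finally show ?thesis
    unfolding e_def .
qed

text \<open>Flipping bit \<open>j\<close> of a coordinate moves it by \<open>2\<^sup>j\<close>, so the energies of the bits of one
  coordinate form a geometric series, dominated by its top bit.\<close>

lemma grid_junta:
  fixes \<delta> L :: real
  assumes "\<delta> > 0"
  defines "L \<equiv> K * 2 ^ M"
  shows "\<exists>S\<subseteq>I. \<delta> * card S \<le> L \<and>
    grid_mean I (2 ^ M) (\<lambda>x. (G x - grid_mean (I - S) (2 ^ M)
        (\<lambda>y. G (\<lambda>i. if i \<in> I - S then y i else x i)))\<^sup>2)
    \<le> L\<^sup>2 / (real d + 1) + 3 ^ d * (L * sqrt (L * \<delta>))"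
proof -
  define T where "T = I \<times> {..<M}"
  define g where "g = (\<lambda>X. G (bit_enc I X))"
  define a where "a i = grid_mean I (2 ^ M) (\<lambda>x. \<bar>G (x(i := Suc (x i))) - G x\<bar>)" for i
  \<comment> \<open>Rescaling by the side of the grid makes the bounds below depend on
    \<open>L\<close> alone: the \<open>\<beta> i\<close> add up to at most \<open>L\<close>,
    whatever \<open>M\<close> is.\<close>
  define \<beta> where "\<beta> i = a i * 2 ^ M" for i
  define S where "S = {i \<in> I. \<beta> i > \<delta>}"
  define R where "R = (I - S) \<times> {..<M}"
  have finT: "finite T" "R \<subseteq> T"
    using finI by (auto simp: T_def R_def)
  have a0: "0 \<le> a i" for i
    unfolding a_def by (rule grid_mean_nonneg) simp
  then have \<beta>0: "0 \<le> \<beta> i" for i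
    by (simp add: \<beta>_def)
  have K0: "0 \<le> K"
  proof -
    have "(\<lambda>i\<in>I. 0) \<in> PiE I (\<lambda>_. {..<2 ^ M :: nat})"
      by simp
    from steps[OF this] show ?thesis
      by (rule order_trans[rotated]) (auto intro: sum_nonneg)
  qed
  then have L0: "0 \<le> L"
    by (simp add: L_def)
  have "(\<Sum>i\<in>I. a i) \<le> K"
    unfolding a_def grid_mean_sum[symmetric] by (intro grid_mean_le finI steps) auto
  then have \<beta>: "(\<Sum>i\<in>I. \<beta> i) \<le> L"
    by (simp add: \<beta>_def L_def flip: sum_distrib_right)
  have geometric: "(\<Sum>j<M. 4 ^ j * c) \<le> 4 ^ M * c" if "0 \<le> c" for c :: real
  proof -
    have "(\<Sum>j<M. 4 ^ j :: real) \<le> 4 ^ M"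
    proof (induction M)
      case (Suc M)
      then show ?case
        using zero_le_power[of "4 :: real" M] by (simp del: zero_le_power)
    qed simp
    then show ?thesis
      using that by (simp add: mult_right_mono flip: sum_distrib_right)
  qed
  have mean: "cube_mean T (\<lambda>X. \<bar>flip_diff g (i, j) X\<bar>) \<le> 2 ^ j * a i" if "i \<in> I" "j < M" for i j
    unfolding T_def g_def a_def using that by (rule flip_diff_mean)
  have energy: "cube_mean T (\<lambda>X. (flip_diff g (i, j) X)\<^sup>2) \<le> 4 ^ j * (K * a i)" if "i \<in> I" "j < M" for i j
  proof -
    have "cube_mean T (\<lambda>X. (flip_diff g (i, j) X)\<^sup>2)
        \<le> cube_mean T (\<lambda>X. (2 ^ j * K) * \<bar>flip_diff g (i, j) X\<bar>)"
    proof (intro cube_mean_mono)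
      fix X assume "X \<subseteq> T"
      then have "\<bar>flip_diff g (i, j) X\<bar> \<le> 2 ^ j * K"
        unfolding T_def g_def using that by (intro flip_diff_sup)
      then have "\<bar>flip_diff g (i, j) X\<bar> * \<bar>flip_diff g (i, j) X\<bar> \<le> (2 ^ j * K) * \<bar>flip_diff g (i, j) X\<bar>"
        by (rule mult_right_mono) simp
      then show "(flip_diff g (i, j) X)\<^sup>2 \<le> (2 ^ j * K) * \<bar>flip_diff g (i, j) X\<bar>"
        by (simp add: power2_eq_square)
    qed
    also have "\<dots> \<le> (2 ^ j * K) * (2 ^ j * a i)"
      unfolding cube_mean_cmult using K0 by (intro mult_left_mono mean that) auto
    also have "\<dots> = 4 ^ j * (K * a i)"
      by (simp flip: power_mult_distrib)
    finally show ?thesis .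
  qed
  have "(\<Sum>t\<in>T. cube_mean T (\<lambda>X. (flip_diff g t X)\<^sup>2)) \<le> (\<Sum>i\<in>I. \<Sum>j<M. 4 ^ j * (K * a i))"
    by (subst (1) T_def, unfold sum.cartesian_product', intro sum_mono energy) auto
  also have "\<dots> \<le> (\<Sum>i\<in>I. 4 ^ M * (K * a i))"
    using K0 a0 by (intro sum_mono geometric) auto
  \<comment> \<open>The factor \<open>4 ^ M\<close> is split evenly: one \<open>2 ^ M\<close> turns
    \<open>K\<close> into \<open>L\<close>, the other turns \<open>a i\<close> into
    \<open>\<beta> i\<close>.\<close>
  also have "\<dots> = L * (\<Sum>i\<in>I. \<beta> i)"
    by (simp add: sum_distrib_left L_def \<beta>_def mult_ac flip: power_mult_distrib)
  also have "\<dots> \<le> L\<^sup>2"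
    unfolding power2_eq_square by (intro mult_left_mono \<beta> L0)
  finally have high: "(\<Sum>t\<in>T. cube_mean T (\<lambda>X. (flip_diff g t X)\<^sup>2)) \<le> L\<^sup>2" .
  have "(\<Sum>t\<in>R. cube_mean T (\<lambda>X. \<bar>flip_diff g t X\<bar>) * sqrt (cube_mean T (\<lambda>X. (flip_diff g t X)\<^sup>2)))
      \<le> (\<Sum>i\<in>I - S. \<Sum>j<M. 4 ^ j * (a i * sqrt (K * a i)))"
    unfolding R_def sum.cartesian_product'
  proof (intro sum_mono)
    fix i j assume i: "i \<in> I - S" and j: "j \<in> {..<M}"
    then have "cube_mean T (\<lambda>X. \<bar>flip_diff g (i, j) X\<bar>) * sqrt (cube_mean T (\<lambda>X. (flip_diff g (i, j) X)\<^sup>2))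
        \<le> (2 ^ j * a i) * sqrt (4 ^ j * (K * a i))"
      by (intro mult_mono mean real_sqrt_le_mono energy mult_nonneg_nonneg a0)
         (auto intro!: cube_mean_nonneg)
    also have "sqrt (4 ^ j * (K * a i)) = 2 ^ j * sqrt (K * a i)"
      using real_sqrt_power[of 4 j] by (simp add: real_sqrt_mult)
    also have "2 ^ j * a i * (2 ^ j * sqrt (K * a i)) = 4 ^ j * (a i * sqrt (K * a i))"
      by (simp flip: power_mult_distrib)
    finally show "cube_mean T (\<lambda>X. \<bar>flip_diff g (i, j) X\<bar>) * sqrt (cube_mean T (\<lambda>X. (flip_diff g (i, j) X)\<^sup>2))
        \<le> 4 ^ j * (a i * sqrt (K * a i))" .
  qed
  also have "\<dots> \<le> (\<Sum>i\<in>I - S. 4 ^ M * (a i * sqrt (K * a i)))"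
    using K0 a0 by (intro sum_mono geometric) auto
  also have "\<dots> = (\<Sum>i\<in>I - S. \<beta> i * sqrt (L * \<beta> i))"
  proof (intro sum.cong refl)
    fix i
    have "sqrt (L * \<beta> i) = 2 ^ M * sqrt (K * a i)"
      using real_sqrt_power[of 4 M] by (simp add: L_def \<beta>_def real_sqrt_mult)
    then show "4 ^ M * (a i * sqrt (K * a i)) = \<beta> i * sqrt (L * \<beta> i)"
      by (simp add: \<beta>_def flip: power_mult_distrib)
  qed
  \<comment> \<open>The choice of \<open>S\<close> enters here: a coordinate outside
    \<open>S\<close> has \<open>\<beta> i\<close> at most \<open>\<delta>\<close>.\<close>
  also have "\<dots> \<le> (\<Sum>i\<in>I - S. \<beta> i * sqrt (L * \<delta>))"
    using L0 \<beta>0 by (intro sum_mono mult_left_mono real_sqrt_le_mono) (auto simp: S_def)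
  also have "\<dots> \<le> (\<Sum>i\<in>I. \<beta> i) * sqrt (L * \<delta>)"
    unfolding sum_distrib_right[symmetric]
    using L0 \<beta>0 finI assms(1) by (intro mult_right_mono sum_mono2) auto
  also have "\<dots> \<le> L * sqrt (L * \<delta>)"
    using L0 assms(1) by (intro mult_right_mono \<beta>) auto
  finally have low: "(\<Sum>t\<in>R. cube_mean T (\<lambda>X. \<bar>flip_diff g t X\<bar>)
      * sqrt (cube_mean T (\<lambda>X. (flip_diff g t X)\<^sup>2))) \<le> L * sqrt (L * \<delta>)" .
  have "grid_mean I (2 ^ M) (\<lambda>x. (G x - grid_mean (I - S) (2 ^ M)
        (\<lambda>y. G (\<lambda>i. if i \<in> I - S then y i else x i)))\<^sup>2)
      = cube_mean T (\<lambda>X. (g X - cube_average_out R g X)\<^sup>2)"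
    unfolding cube_mean_bit_enc[OF finI, symmetric] T_def g_def R_def
    by (intro cube_mean_cong) (subst cube_average_out_bit_enc[OF finI], auto)
  also have "\<dots> \<le> L\<^sup>2 / (real d + 1) + 3 ^ d * (L * sqrt (L * \<delta>))"
    by (rule order_trans[OF Friedgut_inequality[OF finT, of _ d]])
       (intro add_mono divide_right_mono mult_left_mono high low, auto)
  finally have "grid_mean I (2 ^ M) (\<lambda>x. (G x - grid_mean (I - S) (2 ^ M)
        (\<lambda>y. G (\<lambda>i. if i \<in> I - S then y i else x i)))\<^sup>2)
      \<le> L\<^sup>2 / (real d + 1) + 3 ^ d * (L * sqrt (L * \<delta>))" .
  moreover have "\<delta> * card S \<le> L"
  proof -
    have "\<delta> * card S \<le> (\<Sum>i\<in>S. \<beta> i)"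
      using sum_bounded_below[of S \<delta> \<beta>] by (simp add: S_def less_imp_le mult.commute)
    also have "\<dots> \<le> (\<Sum>i\<in>I. \<beta> i)"
      using finI \<beta>0 by (intro sum_mono2) (auto simp: S_def)
    finally show ?thesis
      using \<beta> by simp
  qed
  moreover have "S \<subseteq> I"
    by (auto simp: S_def)
  ultimately show ?thesis
    by blast
qed

end

subsection \<open>Smoothing on grids\<close>

lemma grid_mean_diff: "grid_mean I n f - grid_mean I n g = grid_mean I n (\<lambda>x. f x - g x)"
  by (simp add: grid_mean_def sum_subtractf diff_divide_distrib)

lemma abs_grid_mean_le:
  assumes "finite I" "n > 0" "\<And>x. x \<in> PiE I (\<lambda>_. {..<n}) \<Longrightarrow> \<bar>f x\<bar> \<le> c"
  shows "\<bar>grid_mean I n f\<bar> \<le> c"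
proof -
  have "\<bar>grid_mean I n f\<bar> \<le> grid_mean I n (\<lambda>x. \<bar>f x\<bar>)"
    unfolding grid_mean_def by (simp add: divide_right_mono sum_abs)
  also have "\<dots> \<le> c"
    by (intro grid_mean_le assms)
  finally show ?thesis .
qed

definition adjacent_on :: "'i set \<Rightarrow> ('i \<Rightarrow> nat) \<Rightarrow> ('i \<Rightarrow> nat) \<Rightarrow> bool" where
  "adjacent_on I x y \<longleftrightarrow> (\<forall>i\<in>I. x i \<le> Suc (y i) \<and> y i \<le> Suc (x i))"

text \<open>The intermediate point moves every coordinate of \<open>y\<close> that differs from
  \<open>x\<close> one unit towards it. The induction starts at 1, since points that agree on
  \<open>I\<close> may differ elsewhere and are then merely adjacent.\<close>

lemma adjacent_chain_bound:
  fixes F :: "('i \<Rightarrow> nat) \<Rightarrow> real"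
  assumes step: "\<And>x y. adjacent_on I x y \<Longrightarrow> \<bar>F x - F y\<bar> \<le> \<eta>"
    and "m \<ge> 1" "\<And>i. i \<in> I \<Longrightarrow> x i \<le> y i + m \<and> y i \<le> x i + m"
  shows "\<bar>F x - F y\<bar> \<le> real m * \<eta>"
  using assms(2,3)
proof (induction m arbitrary: y rule: dec_induct)
  case base
  then show ?case
    using step[of x y] by (simp add: adjacent_on_def)
next
  case (step m)
  define z where "z i = (if x i < y i then y i - 1 else if y i < x i then y i + 1 else y i)" for i
  have "\<bar>F x - F z\<bar> \<le> real m * \<eta>"
  proof (rule step.IH)
    fix i assume "i \<in> I"
    then show "x i \<le> z i + m \<and> z i \<le> x i + m"
      using step.prems[of i] by (auto simp: z_def)
  qed
  moreover have "\<bar>F z - F y\<bar> \<le> \<eta>"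
    by (intro assms(1)) (auto simp: adjacent_on_def z_def)
  ultimately show ?case
    by (simp add: algebra_simps)
qed

section \<open>Averages over boxes and a dimension-free gradient bound\<close>

lemma sum_PiE_insert:
  fixes F :: "('i \<Rightarrow> 'b) \<Rightarrow> real"
  assumes "i \<notin> J"
  shows "(\<Sum>c\<in>PiE (insert i J) (\<lambda>_. B). F c) = (\<Sum>c\<in>PiE J (\<lambda>_. B). \<Sum>b\<in>B. F (c(i := b)))"
proof -
  have "(\<Sum>c\<in>PiE (insert i J) (\<lambda>_. B). F c) = (\<Sum>(b, c)\<in>B \<times> PiE J (\<lambda>_. B). F (c(i := b)))"
    unfolding PiE_insert_eq
    by (subst sum.reindex[OF inj_combinator[OF assms]]) (simp add: case_prod_unfold)
  then show ?thesis
    by (subst sum.swap) (simp add: sum.cartesian_product)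
qed

text \<open>The side of the box equals the dimension. A unit difference of the average then varies
  by at most \<open>2 * l / card I\<close> between adjacent points, little enough to be summed over
  all coordinates.\<close>

definition box_mean :: "'i set \<Rightarrow> (('i \<Rightarrow> nat) \<Rightarrow> real) \<Rightarrow> ('i \<Rightarrow> nat) \<Rightarrow> real" where
  "box_mean I F x = grid_mean I (card I) (\<lambda>c. F (\<lambda>i. x i + c i))"

context
  fixes I :: "'i set" and F :: "('i \<Rightarrow> nat) \<Rightarrow> real" and l :: real
  assumes finI: "finite I" and nonempty: "I \<noteq> {}"
    and lip: "\<And>x y. adjacent_on I x y \<Longrightarrow> \<bar>F x - F y\<bar> \<le> l"
begin

lemma card_pos: "0 < card I"
  using finI nonempty by (simp add: card_gt_0_iff)

lemma lip_nonneg: "0 \<le> l"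
  using lip[of "\<lambda>_. 0" "\<lambda>_. 0"] by (simp add: adjacent_on_def)

lemma box_mean_adjacent:
  assumes "adjacent_on I x y"
  shows "\<bar>box_mean I F x - box_mean I F y\<bar> \<le> l"
  unfolding box_mean_def grid_mean_diff
  using assms by (intro abs_grid_mean_le finI card_pos lip) (auto simp: adjacent_on_def)

text \<open>Every point of the box is within \<open>card I\<close> unit steps of its corner. This
  cost grows with the dimension and is compensated later by a small \<open>l\<close>.\<close>

lemma box_mean_close: "\<bar>box_mean I F x - F x\<bar> \<le> card I * l"
proof -
  have mean: "grid_mean I (card I) (\<lambda>_. F x) = F x"
    using nonempty finI by (simp add: grid_mean_def card_PiE)
  have "box_mean I F x - F x = grid_mean I (card I) (\<lambda>c. F (\<lambda>i. x i + c i) - F x)"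
    unfolding grid_mean_diff[symmetric] mean box_mean_def ..
  also have "\<bar>\<dots>\<bar> \<le> card I * l"
  proof (intro abs_grid_mean_le finI card_pos adjacent_chain_bound[of I, OF lip])
    fix c i assume "c \<in> PiE I (\<lambda>_. {..<card I})" "i \<in> I"
    then have "c i < card I"
      by auto
    then show "x i + c i \<le> x i + card I \<and> x i \<le> x i + c i + card I"
      by simp
  qed (use card_pos in auto)
  finally show ?thesis .
qed

text \<open>The unit differences of a box average telescope to face differences, which makes them
  almost constant at unit scale.\<close>

lemma box_mean_difference_adjacent:
  assumes i: "i \<in> I" and xy: "adjacent_on I x y"
  shows "\<bar>(box_mean I F (x(i := Suc (x i))) - box_mean I F x)
        - (box_mean I F (y(i := Suc (y i))) - box_mean I F y)\<bar> \<le> 2 * l / card I"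
proof -
  define n where "n = card I"
  define J where "J = I - {i}"
  have J: "finite J" "i \<notin> J" "I = insert i J" "card J = n - 1"
    using i finI by (auto simp: J_def n_def)
  have n: "n > 0"
    using card_pos by (simp add: n_def)
  define face where "face z c r = F (\<lambda>k. z k + (c(i := r)) k)" for z c r
  have diff: "box_mean I F (z(i := Suc (z i))) - box_mean I F z
      = (\<Sum>c\<in>PiE J (\<lambda>_. {..<n}). face z c n - face z c 0) / real n ^ n" for z
  proof -
    have shift: "F (\<lambda>k. (z(i := Suc (z i))) k + (c(i := r)) k) = face z c (Suc r)" for c r
      unfolding face_def by (rule arg_cong[where f = F]) auto
    have "(\<Sum>c\<in>PiE I (\<lambda>_. {..<n}). F (\<lambda>k. (z(i := Suc (z i))) k + c k) - F (\<lambda>k. z k + c k))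
        = (\<Sum>c\<in>PiE J (\<lambda>_. {..<n}). \<Sum>r<n. face z c (Suc r) - face z c r)"
      by (subst (1) J(3), subst sum_PiE_insert[OF J(2)], subst shift, simp only: face_def)
    also have "\<dots> = (\<Sum>c\<in>PiE J (\<lambda>_. {..<n}). face z c n - face z c 0)"
      by (simp only: sum_lessThan_telescope)
    finally show ?thesis
      unfolding box_mean_def grid_mean_diff unfolding grid_mean_def n_def[symmetric] by simp
  qed
  have "\<bar>(\<Sum>c\<in>PiE J (\<lambda>_. {..<n}). face x c n - face x c 0)
       - (\<Sum>c\<in>PiE J (\<lambda>_. {..<n}). face y c n - face y c 0)\<bar>
       \<le> (\<Sum>c\<in>PiE J (\<lambda>_. {..<n}). 2 * l)"
    unfolding sum_subtractf[symmetric]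
  proof (rule order_trans[OF sum_abs sum_mono])
    fix c
    have "\<bar>face x c r - face y c r\<bar> \<le> l" for r
      unfolding face_def using xy by (intro lip) (auto simp: adjacent_on_def)
    from this[of n] this[of 0]
    show "\<bar>face x c n - face x c 0 - (face y c n - face y c 0)\<bar> \<le> 2 * l"
      by linarith
  qed
  also have "\<dots> = real n ^ (n - 1) * (2 * l)"
    using J by (simp add: card_PiE)
  finally have "\<bar>(\<Sum>c\<in>PiE J (\<lambda>_. {..<n}). face x c n - face x c 0)
       - (\<Sum>c\<in>PiE J (\<lambda>_. {..<n}). face y c n - face y c 0)\<bar> / real n ^ n
       \<le> real n ^ (n - 1) * (2 * l) / real n ^ n"
    by (rule divide_right_mono) simp
  \<comment> \<open>A face has \<open>n ^ (n - 1)\<close> points against \<open>n ^ n\<close> in the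
    box, which gains the factor \<open>1 / n\<close>.\<close>
  also have "\<dots> = 2 * l / n"
    using n by (cases n) simp_all
  finally show ?thesis
    unfolding diff diff_divide_distrib[symmetric] abs_divide n_def[symmetric] by simp
qed

text \<open>Raise the coordinates of \<open>P\<close> one at a time. All intermediate points are
  adjacent to \<open>x\<close>, so each increment differs from the corresponding difference at
  \<open>x\<close> by at most \<open>2 * l / card I\<close>, and these errors add up to at most
  \<open>2 * l\<close>. The combined move is a single adjacent step and costs at most
  \<open>l\<close>, however large \<open>P\<close> is.\<close>

lemma box_mean_partial_gradient:
  assumes "P \<subseteq> I"
  shows "\<bar>\<Sum>i\<in>P. box_mean I F (x(i := Suc (x i))) - box_mean I F x\<bar> \<le> 3 * l"
proof -
  define b where "b = box_mean I F"
  define u where "u i = b (x(i := Suc (x i))) - b x" for i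
  define e where "e P k = (if k \<in> P then Suc (x k) else x k)" for P k
  have adj: "adjacent_on I (e P) x" for P
    by (auto simp: adjacent_on_def e_def)
  have "finite P"
    using assms finI finite_subset by auto
  then have "\<bar>(b (e P) - b x) - (\<Sum>i\<in>P. u i)\<bar> \<le> card P * (2 * l / card I)"
    using assms
  proof (induction P rule: finite_induct)
    case empty
    then show ?case
      by (simp add: e_def)
  next
    case (insert i P)
    have upd: "(e P)(i := Suc (e P i)) = e (insert i P)"
      using insert.hyps by (auto simp: e_def)
    have "\<bar>(b (e (insert i P)) - b (e P)) - u i\<bar> \<le> 2 * l / card I"
      unfolding b_def u_def upd[symmetric]
      using insert.prems by (intro box_mean_difference_adjacent adj) auto
    moreover have "real (card (insert i P)) = card P + 1"
      using insert.hyps by simp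
    then have "real (card (insert i P)) * (2 * l / card I)
        = card P * (2 * l / card I) + 2 * l / card I"
      by (simp only: of_nat_add of_nat_1 distrib_right mult_1)
    moreover have "(\<Sum>j\<in>insert i P. u j) = u i + (\<Sum>j\<in>P. u j)"
      using insert.hyps by simp
    moreover have "\<bar>(b (e P) - b x) - (\<Sum>i\<in>P. u i)\<bar> \<le> card P * (2 * l / card I)"
      using insert by simp
    ultimately show ?case
      by linarith
  qed
  also have "\<dots> \<le> card I * (2 * l / card I)"
    using assms finI lip_nonneg by (intro mult_right_mono) (simp_all add: card_mono)
  also have "\<dots> = 2 * l"
    using card_pos by simp
  finally have "\<bar>(b (e P) - b x) - (\<Sum>i\<in>P. u i)\<bar> \<le> 2 * l" .
  moreover have "\<bar>b (e P) - b x\<bar> \<le> l"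
    unfolding b_def by (rule box_mean_adjacent[OF adj])
  ultimately have "\<bar>\<Sum>i\<in>P. u i\<bar> \<le> 3 * l"
    by linarith
  then show ?thesis
    unfolding u_def b_def .
qed

text \<open>Splitting the coordinates by the sign of their difference removes the absolute values,
  at the price of two applications of the signed bound.\<close>

lemma box_mean_gradient:
  "(\<Sum>i\<in>I. \<bar>box_mean I F (x(i := Suc (x i))) - box_mean I F x\<bar>) \<le> 6 * l"
proof -
  define D where "D i = box_mean I F (x(i := Suc (x i))) - box_mean I F x" for i
  define P where "P = {i \<in> I. D i \<ge> 0}"
  have "(\<Sum>i\<in>I. \<bar>D i\<bar>) = (\<Sum>i\<in>P. \<bar>D i\<bar>) + (\<Sum>i\<in>I - P. \<bar>D i\<bar>)"
    using finI by (subst sum.subset_diff[of P]) (auto simp: P_def)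
  also have "(\<Sum>i\<in>P. \<bar>D i\<bar>) = (\<Sum>i\<in>P. D i)"
    by (intro sum.cong) (auto simp: P_def)
  also have "(\<Sum>i\<in>I - P. \<bar>D i\<bar>) = - (\<Sum>i\<in>I - P. D i)"
    unfolding sum_negf[symmetric] by (intro sum.cong) (auto simp: P_def)
  also have "(\<Sum>i\<in>P. D i) + - (\<Sum>i\<in>I - P. D i) \<le> 3 * l + 3 * l"
    using box_mean_partial_gradient[of P x] box_mean_partial_gradient[of "I - P" x]
    unfolding D_def by (intro add_mono) (auto simp: P_def D_def)
  finally show ?thesis
    by (simp add: D_def)
qed

end

text \<open>McShane's construction: the minimum over \<open>y\<close> of
  \<open>g y + l * D x y\<close> is Lipschitz for the sup distance \<open>D\<close>, and the
  hypothesis on \<open>g\<close> keeps it within \<open>\<eta>\<close> of \<open>g\<close> on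
  \<open>Y\<close>. The additive \<open>\<eta>\<close> thereby moves from the modulus to the
  approximation error. The result is defined off \<open>Y\<close> too, as box averages
  require.\<close>

lemma inf_convolution:
  fixes g :: "('i \<Rightarrow> nat) \<Rightarrow> real" and l \<eta> :: real
  assumes I: "finite I" "I \<noteq> {}" and Y: "finite Y" "Y \<noteq> {}" and "0 \<le> l" "0 \<le> \<eta>"
    and g: "\<And>x y r. x \<in> Y \<Longrightarrow> y \<in> Y \<Longrightarrow> (\<And>i. i \<in> I \<Longrightarrow> \<bar>real (x i) - real (y i)\<bar> \<le> r)
        \<Longrightarrow> g x - g y \<le> \<eta> + l * r"
  obtains F where "\<And>x y. adjacent_on I x y \<Longrightarrow> \<bar>F x - F y\<bar> \<le> l"
    and "\<And>x. x \<in> Y \<Longrightarrow> \<bar>F x - g x\<bar> \<le> \<eta>"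
proof -
  define D where "D x y = Max ((\<lambda>i. \<bar>real (x i) - real (y i)\<bar>) ` I)" for x y :: "'i \<Rightarrow> nat"
  define F where "F x = Min ((\<lambda>y. g y + l * D x y) ` Y)" for x
  have D_ge: "\<bar>real (x i) - real (y i)\<bar> \<le> D x y" if "i \<in> I" for x y i
    unfolding D_def using I that by (intro Max_ge) auto
  have D_le: "D x y \<le> r" if "\<And>i. i \<in> I \<Longrightarrow> \<bar>real (x i) - real (y i)\<bar> \<le> r" for x y r
    unfolding D_def using I that by auto
  have F_le: "F x \<le> g y + l * D x y" if "y \<in> Y" for x y
    unfolding F_def using Y that by (intro Min_le) auto
  have F_attained: "\<exists>y\<in>Y. F x = g y + l * D x y" for x
  proof -
    have "F x \<in> (\<lambda>y. g y + l * D x y) ` Y"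
      unfolding F_def using Y by (intro Min_in) auto
    then show ?thesis by auto
  qed
  have step: "F x - F y \<le> l" if "adjacent_on I x y" for x y
  proof -
    obtain z where z: "z \<in> Y" "F y = g z + l * D y z"
      using F_attained by blast
    have "D x z \<le> D y z + 1"
    proof (rule D_le)
      fix i assume "i \<in> I"
      then show "\<bar>real (x i) - real (z i)\<bar> \<le> D y z + 1"
        using D_ge[of i y z] that unfolding adjacent_on_def by fastforce
    qed
    then have "l * D x z \<le> l * (D y z + 1)"
      using assms(5) by (rule mult_left_mono)
    then show ?thesis
      using F_le[OF z(1), of x] z(2) by (simp add: algebra_simps)
  qed
  show thesis
  proof (rule that)
    show "\<bar>F x - F y\<bar> \<le> l" if "adjacent_on I x y" for x y
      using step[of x y] step[of y x] that by (auto simp: adjacent_on_def)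
    show "\<bar>F x - g x\<bar> \<le> \<eta>" if x: "x \<in> Y" for x
    proof -
      have "D x x \<le> 0"
        by (rule D_le) simp
      then have "l * D x x \<le> 0"
        using assms(5) by (simp add: mult_nonneg_nonpos)
      then have "F x \<le> g x"
        using F_le[OF x, of x] by simp
      moreover obtain y where y: "y \<in> Y" "F x = g y + l * D x y"
        using F_attained by blast
      then have "g x - g y \<le> \<eta> + l * D x y"
        by (intro g x D_ge)
      ultimately show ?thesis
        using y assms(6) by simp
    qed
  qed
qed

text \<open>The error \<open>card I * l\<close> of the box average stays explicit because
  \<open>l\<close> will be chosen according to the dimension.\<close>

lemma Lipschitz_smoothing:
  fixes g :: "('i \<Rightarrow> nat) \<Rightarrow> real" and l \<eta> :: real
  assumes I: "finite I" "I \<noteq> {}" and Y: "finite Y" "Y \<noteq> {}" and l: "0 \<le> l" "0 \<le> \<eta>"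
    and g: "\<And>x y r. x \<in> Y \<Longrightarrow> y \<in> Y \<Longrightarrow> (\<And>i. i \<in> I \<Longrightarrow> \<bar>real (x i) - real (y i)\<bar> \<le> r)
        \<Longrightarrow> g x - g y \<le> \<eta> + l * r"
  obtains G where "\<And>x. (\<Sum>i\<in>I. \<bar>G (x(i := Suc (x i))) - G x\<bar>) \<le> 6 * l"
    and "\<And>x. x \<in> Y \<Longrightarrow> \<bar>G x - g x\<bar> \<le> \<eta> + card I * l"
proof -
  show thesis
  proof (rule inf_convolution[OF I Y l, of g])
    show "g x - g y \<le> \<eta> + l * r"
      if "x \<in> Y" "y \<in> Y" "\<And>i. i \<in> I \<Longrightarrow> \<bar>real (x i) - real (y i)\<bar> \<le> r" for x y r
      using that by (rule g)
  next
    fix F assume F: "\<And>x y. adjacent_on I x y \<Longrightarrow> \<bar>F x - F y\<bar> \<le> l" "\<And>x. x \<in> Y \<Longrightarrow> \<bar>F x - g x\<bar> \<le> \<eta>"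
    show thesis
    proof (rule that)
      show "(\<Sum>i\<in>I. \<bar>box_mean I F (x(i := Suc (x i))) - box_mean I F x\<bar>) \<le> 6 * l" for x
        by (rule box_mean_gradient) (fact I F(1))+
      show "\<bar>box_mean I F x - g x\<bar> \<le> \<eta> + card I * l" if "x \<in> Y" for x
      proof -
        have "\<bar>box_mean I F x - F x\<bar> \<le> card I * l"
          by (rule box_mean_close) (fact I F(1))+
        then show ?thesis
          using F(2)[OF that] by linarith
      qed
    qed
  qed
qed

subsection \<open>The distance to a conditional expectation\<close>

definition merge_on :: "'i set \<Rightarrow> ('i \<Rightarrow> 'b) \<Rightarrow> ('i \<Rightarrow> 'b) \<Rightarrow> 'i \<Rightarrow> 'b" where
  "merge_on R x y = (\<lambda>i. if i \<in> R then y i else x i)"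

lemma measurable_merge_on:
  assumes "R \<subseteq> I"
  shows "(\<lambda>(x, y). merge_on R x y) \<in> PiM I (\<lambda>_. P) \<Otimes>\<^sub>M PiM R (\<lambda>_. P) \<rightarrow>\<^sub>M PiM I (\<lambda>_. P)"
proof -
  have "(\<lambda>z. \<lambda>i\<in>I. if i \<in> R then snd z i else fst z i)
      \<in> PiM I (\<lambda>_. P) \<Otimes>\<^sub>M PiM R (\<lambda>_. P) \<rightarrow>\<^sub>M PiM I (\<lambda>_. P)"
  proof (rule measurable_restrict)
    fix i assume "i \<in> I"
    then show "(\<lambda>z. if i \<in> R then snd z i else fst z i)
        \<in> PiM I (\<lambda>_. P) \<Otimes>\<^sub>M PiM R (\<lambda>_. P) \<rightarrow>\<^sub>M P"
      by (cases "i \<in> R")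
         (simp_all add: measurable_compose[OF measurable_snd measurable_component_singleton]
            measurable_compose[OF measurable_fst measurable_component_singleton])
  qed
  moreover have "(\<lambda>i\<in>I. if i \<in> R then snd z i else fst z i) = (case z of (x, y) \<Rightarrow> merge_on R x y)"
    if "z \<in> space (PiM I (\<lambda>_. P) \<Otimes>\<^sub>M PiM R (\<lambda>_. P))" for z
    using that assms by (auto simp: merge_on_def space_pair_measure space_PiM PiE_def extensional_def fun_eq_iff)
  ultimately show ?thesis
    by (simp cong: measurable_cong)
qed

lemma measurable_merge_on_right:
  assumes "R \<subseteq> I" "x \<in> space (PiM I (\<lambda>_. P))"
  shows "merge_on R x \<in> PiM R (\<lambda>_. P) \<rightarrow>\<^sub>M PiM I (\<lambda>_. P)"
  using measurable_compose[OF measurable_Pair1'[OF assms(2)] measurable_merge_on[OF assms(1)]]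
  by simp

lemma measurable_compose_restrict:
  assumes "\<phi> \<in> P \<rightarrow>\<^sub>M Q"
  shows "compose I \<phi> \<in> PiM I (\<lambda>_. P) \<rightarrow>\<^sub>M PiM I (\<lambda>_. Q)"
  unfolding compose_def
  using assms by (intro measurable_restrict measurable_compose[OF measurable_component_singleton])

section \<open>Composed conditional expectations as a single integral\<close>

context prob_space
begin

lemma integral_PiM_bounded:
  fixes f :: "('i \<Rightarrow> 'a) \<Rightarrow> real"
  assumes f: "f \<in> borel_measurable (PiM I (\<lambda>_. M))" "\<And>x. x \<in> space (PiM I (\<lambda>_. M)) \<Longrightarrow> \<bar>f x\<bar> \<le> B"
  shows "integrable (PiM I (\<lambda>_. M)) f" and "\<bar>\<integral>x. f x \<partial>PiM I (\<lambda>_. M)\<bar> \<le> B"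
proof -
  interpret P: prob_space "PiM I (\<lambda>_. M)"
    by (rule prob_space_PiM) (rule prob_space_axioms)
  show int: "integrable (PiM I (\<lambda>_. M)) f"
    by (rule P.integrable_const_bound[where B = B]) (use f in auto)
  have "\<bar>\<integral>x. f x \<partial>PiM I (\<lambda>_. M)\<bar> \<le> (\<integral>x. \<bar>f x\<bar> \<partial>PiM I (\<lambda>_. M))"
    by (rule integral_abs_bound)
  also have "\<dots> \<le> (\<integral>x. B \<partial>PiM I (\<lambda>_. M))"
    using int f(2) by (intro integral_mono) auto
  finally show "\<bar>\<integral>x. f x \<partial>PiM I (\<lambda>_. M)\<bar> \<le> B"
    by (simp add: P.prob_space)
qed

lemma measurable_integrate_out:
  assumes "n \<in> I" and [measurable]: "f \<in> borel_measurable (PiM I (\<lambda>_. M))"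
  shows "integrate_out M n f \<in> borel_measurable (PiM I (\<lambda>_. M))"
proof -
  have "(\<lambda>z. (fst z)(n := snd z)) \<in> PiM I (\<lambda>_. M) \<Otimes>\<^sub>M M \<rightarrow>\<^sub>M PiM I (\<lambda>_. M)"
    using assms(1) by (intro measurable_fun_upd[where J = I]) auto
  then have "(\<lambda>(x, y). f (x(n := y))) \<in> borel_measurable (PiM I (\<lambda>_. M) \<Otimes>\<^sub>M M)"
    by (simp add: case_prod_unfold)
  then show ?thesis
    unfolding integrate_out_def by (rule borel_measurable_lebesgue_integral)
qed

text \<open>The last element of the list is integrated innermost, so the induction runs from the
  end: the hypothesis applies to \<open>integrate_out M n f\<close>, and Fubini joins
  \<open>n\<close> to the product. Boundedness supplies integrability throughout.\<close>

lemma foldr_integrate_out: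
  assumes "finite I" "distinct ns" "set ns \<subseteq> I"
    and f: "f \<in> borel_measurable (PiM I (\<lambda>_. M))" "\<And>x. x \<in> space (PiM I (\<lambda>_. M)) \<Longrightarrow> \<bar>f x\<bar> \<le> B"
    and x: "x \<in> space (PiM I (\<lambda>_. M))"
  shows "foldr (integrate_out M) ns f x = (\<integral>y. f (merge_on (set ns) x y) \<partial>PiM (set ns) (\<lambda>_. M))"
  using assms(2-5)
proof (induction ns arbitrary: f rule: rev_induct)
  case Nil
  interpret P: prob_space "PiM {} (\<lambda>_ :: nat. M)"
    by (rule prob_space_PiM) (rule prob_space_axioms)
  show ?case
    using P.prob_space by (simp add: merge_on_def)
next
  case (snoc n ns)
  interpret product_sigma_finite "\<lambda>_. M"
    by standard
  have n: "n \<in> I" "n \<notin> set ns" "finite (set ns)" "set ns \<subseteq> I" "insert n (set ns) \<subseteq> I"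
    using snoc.prems by auto
  have upd: "z(n := w) \<in> space (PiM I (\<lambda>_. M))" if "z \<in> space (PiM I (\<lambda>_. M))" "w \<in> space M" for z w
    using that n(1) by (auto simp: space_PiM PiE_def extensional_def)
  have bound: "\<bar>integrate_out M n f z\<bar> \<le> B" if z: "z \<in> space (PiM I (\<lambda>_. M))" for z
  proof -
    have "(\<lambda>w. z(n := w)) \<in> M \<rightarrow>\<^sub>M PiM I (\<lambda>_. M)"
      using z n(1) by (intro measurable_fun_upd[where J = I]) auto
    then have meas: "(\<lambda>w. f (z(n := w))) \<in> borel_measurable M"
      using snoc.prems(3) by (rule measurable_compose)
    have int: "integrable M (\<lambda>w. f (z(n := w)))"
      by (rule integrable_const_bound[where B = B]) (use meas snoc.prems(4) upd z in auto)
    have "\<bar>integrate_out M n f z\<bar> \<le> (\<integral>w. \<bar>f (z(n := w))\<bar> \<partial>M)"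
      unfolding integrate_out_def by (rule integral_abs_bound)
    also have "\<dots> \<le> (\<integral>w. B \<partial>M)"
      using int upd z snoc.prems(4) by (intro integral_mono) auto
    finally show ?thesis
      by (simp add: prob_space)
  qed
  have "foldr (integrate_out M) (ns @ [n]) f x
      = (\<integral>y. integrate_out M n f (merge_on (set ns) x y) \<partial>PiM (set ns) (\<lambda>_. M))"
    using snoc.prems n bound by (simp, intro snoc.IH measurable_integrate_out) auto
  also have "\<dots> = (\<integral>y. (\<integral>w. f (merge_on (insert n (set ns)) x (y(n := w))) \<partial>M) \<partial>PiM (set ns) (\<lambda>_. M))"
    unfolding integrate_out_def
    by (intro Bochner_Integration.integral_cong refl arg_cong[where f = f]) (auto simp: merge_on_def)
  also have "\<dots> = (\<integral>y. f (merge_on (insert n (set ns)) x y) \<partial>PiM (insert n (set ns)) (\<lambda>_. M))"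
  proof (rule product_integral_insert[symmetric, OF n(3,2)])
    have m: "merge_on (insert n (set ns)) x \<in> PiM (insert n (set ns)) (\<lambda>_. M) \<rightarrow>\<^sub>M PiM I (\<lambda>_. M)"
      by (rule measurable_merge_on_right[OF n(5) x])
    show "integrable (PiM (insert n (set ns)) (\<lambda>_. M)) (\<lambda>y. f (merge_on (insert n (set ns)) x y))"
      by (rule integral_PiM_bounded(1)[where B = B])
         (use measurable_compose[OF m snoc.prems(3)] measurable_space[OF m] snoc.prems(4) in auto)
  qed
  finally show ?case
    by simp
qed

end

section \<open>Transport of the approximation error between measures\<close>

definition junta_error :: "'b measure \<Rightarrow> 'i set \<Rightarrow> 'i set \<Rightarrow> (('i \<Rightarrow> 'b) \<Rightarrow> real) \<Rightarrow> ennreal" where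
  "junta_error P I R f =
    (\<integral>\<^sup>+x. ennreal \<bar>f x - (\<integral>y. f (merge_on R x y) \<partial>PiM R (\<lambda>_. P))\<bar> \<partial>PiM I (\<lambda>_. P))"

lemma measurable_integral_merge_on:
  fixes f :: "('i \<Rightarrow> 'b) \<Rightarrow> real"
  assumes "prob_space P" "R \<subseteq> I" "f \<in> borel_measurable (PiM I (\<lambda>_. P))"
  shows "(\<lambda>x. \<integral>y. f (merge_on R x y) \<partial>PiM R (\<lambda>_. P)) \<in> borel_measurable (PiM I (\<lambda>_. P))"
proof -
  interpret Q: prob_space "PiM R (\<lambda>_. P)"
    by (rule prob_space_PiM) (rule assms)
  show ?thesis
    using measurable_compose[OF measurable_merge_on[OF assms(2)] assms(3)]
    by (intro Q.borel_measurable_lebesgue_integral) (simp add: case_prod_unfold)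
qed

text \<open>Bounded functions allow all omitted coordinates to be integrated out in one product
  integral. In this form the error makes sense over any index set and can be moved from one measure
  to another.\<close>

lemma L1_norm_cond_exp_on:
  fixes f :: "(nat \<Rightarrow> 'b) \<Rightarrow> real"
  assumes "prob_space P" "f \<in> borel_measurable (pow_measure N P)"
    "\<And>x. x \<in> space (pow_measure N P) \<Longrightarrow> \<bar>f x\<bar> \<le> B"
  shows "L1_norm (pow_measure N P) (\<lambda>x. f x - cond_exp_on N P S f x)
    = junta_error P {1..N} ({1..N} - S) f"
proof -
  interpret prob_space P by fact
  have "cond_exp_on N P S f x = (\<integral>y. f (merge_on ({1..N} - S) x y) \<partial>PiM ({1..N} - S) (\<lambda>_. P))"
    if "x \<in> space (pow_measure N P)" for x
    using foldr_integrate_out[of "{1..N}" "sorted_list_of_set ({1..N} - S)" f B x] assms that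
    by (simp add: cond_exp_on_def pow_measure_def)
  then show ?thesis
    unfolding L1_norm_def junta_error_def pow_measure_def by (intro nn_integral_cong) simp
qed

text \<open>A coordinatewise map commutes with \<open>merge_on\<close> and carries product measures
  to product measures, so the change of variables can be made in the inner and the outer integral
  alike.\<close>

lemma junta_error_distr:
  fixes f :: "('i \<Rightarrow> 'b) \<Rightarrow> real"
  assumes P: "prob_space P" and \<phi>: "\<phi> \<in> P \<rightarrow>\<^sub>M Q" "distr P Q \<phi> = Q"
    and "finite I" "R \<subseteq> I" and f: "f \<in> borel_measurable (PiM I (\<lambda>_. Q))"
  shows "junta_error Q I R f = junta_error P I R (\<lambda>x. f (compose I \<phi> x))"
proof -
  have Q: "prob_space Q"
    using prob_space.prob_space_distr[OF P \<phi>(1)] \<phi>(2) by simp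
  have push: "PiM J (\<lambda>_. Q) = distr (PiM J (\<lambda>_. P)) (PiM J (\<lambda>_. Q)) (compose J \<phi>)" if "finite J" for J :: "'i set"
    using distr_PiM_finite_prob_space'[of J "\<lambda>_. P" "\<lambda>_. Q" \<phi>] that P Q \<phi> by simp
  note meas = measurable_compose_restrict[OF \<phi>(1)]
  have "finite R"
    using assms(4,5) finite_subset by auto
  have inner: "(\<integral>y. f (merge_on R (compose I \<phi> x) y) \<partial>PiM R (\<lambda>_. Q))
      = (\<integral>y. f (compose I \<phi> (merge_on R x y)) \<partial>PiM R (\<lambda>_. P))" if x: "x \<in> space (PiM I (\<lambda>_. P))" for x
  proof -
    have "merge_on R (compose I \<phi> x) \<in> PiM R (\<lambda>_. Q) \<rightarrow>\<^sub>M PiM I (\<lambda>_. Q)"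
      using measurable_space[OF meas x] by (rule measurable_merge_on_right[OF assms(5)])
    from measurable_compose[OF this f]
    have "(\<integral>y. f (merge_on R (compose I \<phi> x) y) \<partial>PiM R (\<lambda>_. Q))
      = (\<integral>y. f (merge_on R (compose I \<phi> x) (compose R \<phi> y)) \<partial>PiM R (\<lambda>_. P))"
      by (subst push[OF \<open>finite R\<close>], intro integral_distr meas)
    moreover have "merge_on R (compose I \<phi> x) (compose R \<phi> y) = compose I \<phi> (merge_on R x y)" for y
      using assms(5) by (auto simp: merge_on_def compose_def fun_eq_iff)
    ultimately show ?thesis
      by simp
  qed
  have "junta_error Q I R f = (\<integral>\<^sup>+x. ennreal \<bar>f (compose I \<phi> x)
      - (\<integral>y. f (merge_on R (compose I \<phi> x) y) \<partial>PiM R (\<lambda>_. Q))\<bar> \<partial>PiM I (\<lambda>_. P))"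
    unfolding junta_error_def
    using measurable_integral_merge_on[OF Q assms(5) f] f
    by (subst push[OF assms(4)], intro nn_integral_distr meas) auto
  also have "\<dots> = junta_error P I R (\<lambda>x. f (compose I \<phi> x))"
    unfolding junta_error_def by (intro nn_integral_cong) (simp add: inner)
  finally show ?thesis .
qed

text \<open>The perturbation enters twice, through the function and through its average: hence the
  factor 2.\<close>

lemma junta_error_close:
  fixes f g :: "('i \<Rightarrow> 'b) \<Rightarrow> real"
  assumes P: "prob_space P" and "R \<subseteq> I"
    and f: "f \<in> borel_measurable (PiM I (\<lambda>_. P))" "\<And>x. x \<in> space (PiM I (\<lambda>_. P)) \<Longrightarrow> \<bar>f x\<bar> \<le> B"
    and g: "g \<in> borel_measurable (PiM I (\<lambda>_. P))"
    and fg: "\<And>x. x \<in> space (PiM I (\<lambda>_. P)) \<Longrightarrow> \<bar>f x - g x\<bar> \<le> \<eta>"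
    and "0 \<le> \<eta>"
  shows "junta_error P I R f \<le> junta_error P I R g + ennreal (2 * \<eta>)"
proof -
  interpret PI: prob_space "PiM I (\<lambda>_. P)"
    by (rule prob_space_PiM) (rule P)
  define e where "e h x = (\<integral>y. h (merge_on R x y) \<partial>PiM R (\<lambda>_. P))" for h :: "('i \<Rightarrow> 'b) \<Rightarrow> real" and x
  have ge: "e g \<in> borel_measurable (PiM I (\<lambda>_. P))"
    unfolding e_def by (rule measurable_integral_merge_on[OF P assms(2) g])
  have e: "\<bar>e f x - e g x\<bar> \<le> \<eta>" if x: "x \<in> space (PiM I (\<lambda>_. P))" for x
  proof -
    have m: "merge_on R x \<in> PiM R (\<lambda>_. P) \<rightarrow>\<^sub>M PiM I (\<lambda>_. P)"
      by (rule measurable_merge_on_right[OF assms(2) x])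
    have gB: "\<bar>g z\<bar> \<le> B + \<eta>" if "z \<in> space (PiM I (\<lambda>_. P))" for z
      using f(2)[OF that] fg[OF that] by linarith
    have "e f x - e g x = (\<integral>y. f (merge_on R x y) - g (merge_on R x y) \<partial>PiM R (\<lambda>_. P))"
      unfolding e_def
      by (intro Bochner_Integration.integral_diff[symmetric]
            prob_space.integral_PiM_bounded(1)[OF P, where B = B]
            prob_space.integral_PiM_bounded(1)[OF P, where B = "B + \<eta>"]
            measurable_compose[OF m] f g)
         (use measurable_space[OF m] f(2) gB in auto)
    also have "\<bar>\<dots>\<bar> \<le> \<eta>"
      by (intro prob_space.integral_PiM_bounded(2)[OF P] borel_measurable_diff measurable_compose[OF m] f g)
         (use measurable_space[OF m] fg in auto)
    finally show ?thesis .
  qed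
  have "junta_error P I R f \<le> (\<integral>\<^sup>+x. ennreal \<bar>g x - e g x\<bar> + ennreal (2 * \<eta>) \<partial>PiM I (\<lambda>_. P))"
    unfolding junta_error_def e_def[symmetric]
  proof (rule nn_integral_mono)
    fix x assume x: "x \<in> space (PiM I (\<lambda>_. P))"
    have "\<bar>f x - e f x\<bar> \<le> \<bar>g x - e g x\<bar> + 2 * \<eta>"
      using fg[OF x] e[OF x] by linarith
    then show "ennreal \<bar>f x - e f x\<bar> \<le> ennreal \<bar>g x - e g x\<bar> + ennreal (2 * \<eta>)"
      using assms(7) by (simp flip: ennreal_plus add: ennreal_leI)
  qed
  also have "\<dots> = junta_error P I R g + ennreal (2 * \<eta>)"
    unfolding junta_error_def e_def[symmetric]
    using g ge by (subst nn_integral_add) (auto simp: PI.emeasure_space_1)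
  finally show ?thesis .
qed

section \<open>The error for the uniform measure on a grid\<close>

lemma PiM_uniform_count_measure:
  assumes "finite I" "n > 0"
  shows "PiM I (\<lambda>_. uniform_count_measure {..<n :: nat}) = uniform_count_measure (PiE I (\<lambda>_. {..<n}))"
proof -
  interpret product_sigma_finite "\<lambda>_ :: 'a. uniform_count_measure {..<n}"
    by (intro product_sigma_finite.intro prob_space_imp_sigma_finite prob_space_uniform_count_measure)
       (use assms in auto)
  have "sets (uniform_count_measure (PiE I (\<lambda>_. {..<n})))
      = sets (PiM I (\<lambda>_ :: 'a. count_space {..<n}))"
    using assms(1) by (subst count_space_PiM_finite) (auto simp: sets_uniform_count_measure)
  also have "\<dots> = sets (PiM I (\<lambda>_ :: 'a. uniform_count_measure {..<n}))"
    by (rule sets_PiM_cong) (auto simp: sets_uniform_count_measure)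
  finally have sets: "sets (uniform_count_measure (PiE I (\<lambda>_. {..<n})))
      = sets (PiM I (\<lambda>_ :: 'a. uniform_count_measure {..<n}))" .
  show ?thesis
  proof (rule PiM_eqI[OF assms(1) sets, symmetric])
    fix A assume A: "\<And>i. i \<in> I \<Longrightarrow> A i \<in> sets (uniform_count_measure {..<n})"
    then have A': "A i \<subseteq> {..<n}" if "i \<in> I" for i
      using that by (auto simp: sets_uniform_count_measure)
    then have fin: "finite (A i)" if "i \<in> I" for i
      using that finite_subset by blast
    have "emeasure (uniform_count_measure (PiE I (\<lambda>_. {..<n}))) (PiE I A)
        = ennreal (real (card (PiE I A)) / real (card (PiE I (\<lambda>_. {..<n}))))"
      using A' assms by (intro emeasure_uniform_count_measure finite_PiE PiE_mono) auto
    also have "\<dots> = ennreal (\<Prod>i\<in>I. real (card (A i)) / real n)"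
      using assms by (simp add: card_PiE prod_dividef)
    also have "\<dots> = (\<Prod>i\<in>I. emeasure (uniform_count_measure {..<n}) (A i))"
      using A' by (simp add: emeasure_uniform_count_measure prod_ennreal)
    finally show "emeasure (uniform_count_measure (PiE I (\<lambda>_. {..<n}))) (PiE I A)
        = (\<Prod>i\<in>I. emeasure (uniform_count_measure {..<n}) (A i))" .
  qed
qed

lemma junta_error_uniform:
  assumes "finite I" "R \<subseteq> I" "n > 0"
  shows "junta_error (uniform_count_measure {..<n}) I R f
    = ennreal (grid_mean I n (\<lambda>x. \<bar>f x - grid_mean R n (\<lambda>y. f (merge_on R x y))\<bar>))"
proof -
  have finR: "finite R"
    using assms finite_subset by auto
  have fin: "finite (PiE J (\<lambda>_. {..<n}))" if "finite J" for J :: "'a set"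
    using that by (simp add: finite_PiE)
  have card: "real (card (PiE J (\<lambda>_. {..<n}))) = real n ^ card J" if "finite J" for J :: "'a set"
    using that by (simp add: card_PiE)
  have "(\<integral>y. f (merge_on R x y) \<partial>PiM R (\<lambda>_. uniform_count_measure {..<n}))
      = grid_mean R n (\<lambda>y. f (merge_on R x y))" for x
    unfolding PiM_uniform_count_measure[OF finR assms(3)]
    unfolding uniform_count_measure_def
    by (subst lebesgue_integral_point_measure_finite)
       (simp_all add: fin finR card grid_mean_def sum_divide_distrib)
  then have "junta_error (uniform_count_measure {..<n}) I R f
    = (\<Sum>x\<in>PiE I (\<lambda>_. {..<n}). ennreal (1 / real n ^ card I)
        * ennreal \<bar>f x - grid_mean R n (\<lambda>y. f (merge_on R x y))\<bar>)"
    unfolding junta_error_def PiM_uniform_count_measure[OF assms(1,3)]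
    unfolding uniform_count_measure_def
    using assms(1) by (subst nn_integral_point_measure_finite) (simp_all add: fin card mult.commute)
  then show ?thesis
    by (simp add: grid_mean_def sum_divide_distrib flip: ennreal_mult'' )
qed

text \<open>Cauchy-Schwarz passes from the mean square, which Fourier analysis controls, to the L1
  norm of the goal.\<close>

lemma grid_mean_abs_le_sqrt:
  assumes "finite I" "n > 0"
  shows "grid_mean I n (\<lambda>x. \<bar>f x\<bar>) \<le> sqrt (grid_mean I n (\<lambda>x. (f x)\<^sup>2))"
proof (rule real_le_rsqrt)
  define A where "A = PiE I (\<lambda>_ :: 'a. {..<n})"
  have "(\<Sum>x\<in>A. 1 * \<bar>f x\<bar>)\<^sup>2 \<le> (\<Sum>x\<in>A. 1\<^sup>2) * (\<Sum>x\<in>A. \<bar>f x\<bar>\<^sup>2)"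
    by (rule Cauchy_Schwarz_ineq_sum)
  moreover have "real (card A) = real n ^ card I"
    using assms by (simp add: A_def card_PiE)
  ultimately have "(\<Sum>x\<in>A. \<bar>f x\<bar>)\<^sup>2 \<le> real n ^ card I * (\<Sum>x\<in>A. (f x)\<^sup>2)"
    by simp
  then show "(grid_mean I n (\<lambda>x. \<bar>f x\<bar>))\<^sup>2 \<le> grid_mean I n (\<lambda>x. (f x)\<^sup>2)"
    using assms unfolding grid_mean_def A_def[symmetric]
    by (simp add: power_divide power2_eq_square divide_simps mult_ac)
qed

subsection \<open>Walks and the unit interval\<close>

text \<open>If \<open>z1\<close> were out of reach, consider the open \<open>r\<close>-balls about
  the points reachable from \<open>z0\<close> and those about the other points of \<open>Z\<close>.
  Together they cover \<open>K\<close>, and balls of the two kinds cannot meet, since meeting balls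
  give a link shorter than \<open>2 * r\<close>; so they would disconnect \<open>K\<close>.\<close>

lemma connected_net_chains:
  fixes K :: "'a::metric_space set"
  assumes K: "connected K" and Z: "Z \<subseteq> K" and net: "\<And>y. y \<in> K \<Longrightarrow> \<exists>z\<in>Z. dist y z < r"
    and z: "z0 \<in> Z" "z1 \<in> Z"
  shows "(z0, z1) \<in> {(x, y). x \<in> Z \<and> y \<in> Z \<and> dist x y < 2 * r}\<^sup>*"
proof (rule ccontr)
  define E where "E = {(x, y). x \<in> Z \<and> y \<in> Z \<and> dist x y < 2 * r}"
  define A where "A = {z \<in> Z. (z0, z) \<in> E\<^sup>*}"
  define U where "U = (\<Union>a\<in>A. ball a r)"
  define V where "V = (\<Union>b\<in>Z - A. ball b r)"
  assume "(z0, z1) \<notin> {(x, y). x \<in> Z \<and> y \<in> Z \<and> dist x y < 2 * r}\<^sup>*"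
  then have z1: "z1 \<in> Z - A" and z0: "z0 \<in> A"
    using z by (auto simp: A_def E_def)
  have "r > 0"
    using net[of z0] z Z by (force intro: le_less_trans[OF zero_le_dist])
  have "U \<inter> V = {}"
  proof (rule ccontr)
    assume "U \<inter> V \<noteq> {}"
    then obtain x where "x \<in> U" "x \<in> V"
      by blast
    then obtain a b where ab: "a \<in> A" "b \<in> Z - A" "dist a x < r" "dist b x < r"
      unfolding U_def V_def mem_ball UN_iff by blast
    then have "(a, b) \<in> E"
      using dist_triangle_less_add[of a x r b r] by (auto simp: E_def A_def)
    then have "(z0, b) \<in> E\<^sup>*"
      using ab(1) by (auto simp: A_def intro: rtrancl_into_rtrancl)
    then show False
      using ab(2) by (simp add: A_def)
  qed
  moreover have "K \<subseteq> U \<union> V"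
  proof
    fix y assume "y \<in> K"
    then obtain z where "z \<in> Z" "dist y z < r"
      using net by blast
    then show "y \<in> U \<union> V"
      by (cases "z \<in> A") (auto simp: U_def V_def dist_commute)
  qed
  moreover have "open U" "open V"
    by (auto simp: U_def V_def)
  ultimately have "U \<inter> K = {} \<or> V \<inter> K = {}"
    using connectedD[OF K, of U V] by blast
  moreover have "z0 \<in> U" "z1 \<in> V"
    unfolding U_def V_def using centre_in_ball[THEN iffD2, OF \<open>r > 0\<close>] z0 z1 by blast+
  ultimately show False
    using z Z by blast
qed

text \<open>Chains from the current end point to each point of \<open>Z\<close> in turn are
  concatenated; points may be visited repeatedly.\<close>

lemma covering_walk:
  fixes Z :: "'a::metric_space set"
  assumes "finite Z" "Z \<noteq> {}" "\<delta> > 0"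
    and chains: "\<And>x y. x \<in> Z \<Longrightarrow> y \<in> Z \<Longrightarrow> (x, y) \<in> {(x, y). x \<in> Z \<and> y \<in> Z \<and> dist x y < \<delta>}\<^sup>*"
  obtains w :: "nat \<Rightarrow> 'a" and k where "w ` {..<k} = Z" "\<And>s. dist (w s) (w (Suc s)) < \<delta>"
proof -
  define P where "P xs \<longleftrightarrow> xs \<noteq> [] \<and> set xs \<subseteq> Z \<and> successively (\<lambda>x y. dist x y < \<delta>) xs" for xs
  have extend: "\<exists>ys. P (xs @ ys) \<and> last (xs @ ys) = z"
    if "(last xs, z) \<in> {(x, y). x \<in> Z \<and> y \<in> Z \<and> dist x y < \<delta>}\<^sup>*" "P xs" for xs z
    using that
  proof (induction rule: rtrancl_induct)
    case base
    then show ?case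
      by (intro exI[of _ "[]"]) simp
  next
    case (step y z)
    then obtain ys where ys: "P (xs @ ys)" "last (xs @ ys) = y"
      by blast
    have "P ((xs @ ys) @ [z])"
      using ys step.hyps successively_append_iff[of "\<lambda>x y. dist x y < \<delta>" "xs @ ys" "[z]"]
      by (simp add: P_def del: append_assoc last_appendR)
    then show ?case
      by (intro exI[of _ "ys @ [z]"]) simp
  qed
  have cover: "\<exists>xs. P xs \<and> A \<subseteq> set xs" if "A \<subseteq> Z" for A
    using finite_subset[OF that assms(1)] that
  proof (induction A rule: finite_induct)
    case empty
    obtain z where "z \<in> Z"
      using assms by auto
    then show ?case
      by (intro exI[of _ "[z]"]) (simp add: P_def)
  next
    case (insert a A)
    then obtain xs where xs: "P xs" "A \<subseteq> set xs"
      by auto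
    have "last xs \<in> Z"
      using xs(1) last_in_set by (auto simp: P_def)
    then obtain ys where ys: "P (xs @ ys)" "last (xs @ ys) = a"
      using extend[OF chains xs(1), of a] insert.prems by auto
    then have "a \<in> set (xs @ ys)"
      using last_in_set[of "xs @ ys"] unfolding P_def by metis
    then show ?case
      using xs ys by (intro exI[of _ "xs @ ys"]) auto
  qed
  obtain xs where xs: "P xs" "Z \<subseteq> set xs"
    using cover by blast
  show thesis
  proof
    \<comment> \<open>The walk rests at its last point for ever, so that the step bound holds for
      every \<open>s\<close> and not only below \<open>k\<close>.\<close>
    have "(\<lambda>s. xs ! min s (length xs - 1)) ` {..<length xs} = set xs"
      by (force simp: set_conv_nth min_def image_iff)
    then show "(\<lambda>s. xs ! min s (length xs - 1)) ` {..<length xs} = Z"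
      using xs by (auto simp: P_def)
    show "dist (xs ! min s (length xs - 1)) (xs ! min (Suc s) (length xs - 1)) < \<delta>" for s
    proof (cases "Suc s < length xs")
      case True
      then have "dist (xs ! s) (xs ! Suc s) < \<delta>"
        using xs(1) by (simp add: P_def successively_conv_nth)
      then show ?thesis
        using True assms(3) by (simp add: min_def)
    next
      case False
      then have "min s (length xs - 1) = min (Suc s) (length xs - 1)"
        by auto
      then show ?thesis
        using assms(3) by simp
    qed
  qed
qed

section \<open>Lebesgue measure on the half-open unit interval\<close>

definition unit_interval :: "real measure" where
  "unit_interval = restrict_space lborel {0..<1}"

lemma prob_space_unit_interval: "prob_space unit_interval"
  by (rule prob_spaceI) (simp add: unit_interval_def emeasure_restrict_space space_restrict_space)

lemma space_unit_interval: "space unit_interval = {0..<1}"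
  by (simp add: unit_interval_def space_restrict_space)

lemma emeasure_unit_interval:
  assumes "0 \<le> a" "a \<le> b" "b \<le> 1"
  shows "emeasure unit_interval {a..<b} = ennreal (b - a)"
  using assms by (simp add: unit_interval_def emeasure_restrict_space)

lemma sets_unit_interval:
  assumes "0 \<le> a" "b \<le> 1"
  shows "{a..<b} \<in> sets unit_interval"
  using assms by (auto simp: unit_interval_def sets_restrict_space_iff)

text \<open>The interval is cut into consecutive blocks of lengths \<open>l s\<close>. On the way
  from one block to another, only the blocks strictly in between are crossed completely, each of
  length at least \<open>\<kappa>\<close>; the additive 1 accounts for the rest.\<close>

lemma interval_blocks:
  fixes l :: "nat \<Rightarrow> real"
  assumes k: "k > 0" and l: "\<And>s. s < k \<Longrightarrow> \<kappa> \<le> l s" and "\<kappa> > 0" and sum: "(\<Sum>s<k. l s) = 1"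
  obtains b :: "real \<Rightarrow> nat" where
    "b \<in> unit_interval \<rightarrow>\<^sub>M count_space {..<k}"
    "\<And>s. s < k \<Longrightarrow> emeasure unit_interval {u \<in> space unit_interval. b u = s} = ennreal (l s)"
    "\<And>u v. u \<in> {0..<1} \<Longrightarrow> v \<in> {0..<1} \<Longrightarrow> real (b u) \<le> real (b v) + 1 + \<bar>u - v\<bar> / \<kappa>"
proof -
  define t where "t m = (\<Sum>s<m. l s)" for m
  define b where "b u = (LEAST s. u < t (Suc s))" for u
  have gap: "real (m' - m) * \<kappa> \<le> t m' - t m" if "m \<le> m'" "m' \<le> k" for m m'
    using that
  proof (induction m' rule: dec_induct)
    case (step n)
    then show ?case
      using l[of n] by (simp add: t_def Suc_diff_le algebra_simps)
  qed simp
  have t_mono: "t m \<le> t m'" if "m \<le> m'" "m' \<le> k" for m m'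
    using gap[OF that] mult_nonneg_nonneg[OF of_nat_0_le_iff less_imp_le[OF \<open>\<kappa> > 0\<close>], of "m' - m"]
    by linarith
  have t01: "t 0 = 0" "t k = 1"
    using sum by (simp_all add: t_def)
  have b: "b u < k" "t (b u) \<le> u" "u < t (Suc (b u))" if "u \<in> {0..<1}" for u
  proof -
    have ex: "u < t (Suc (k - 1))"
      using k t01 that by simp
    show "u < t (Suc (b u))"
      unfolding b_def by (rule LeastI[of _ "k - 1"]) (rule ex)
    have "b u \<le> k - 1"
      unfolding b_def by (rule Least_le) (rule ex)
    then show "b u < k"
      using k by simp
    show "t (b u) \<le> u"
    proof (cases "b u")
      case 0
      then show ?thesis
        using t01 that by simp
    next
      case (Suc m)
      then have "\<not> u < t (Suc m)"
        using not_less_Least[of m "\<lambda>s. u < t (Suc s)"] unfolding b_def by simp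
      then show ?thesis
        using Suc by simp
    qed
  qed
  have fibre: "{u \<in> space unit_interval. b u = s} = {t s..<t (Suc s)}" if s: "s < k" for s
  proof (intro set_eqI iffI)
    fix u assume "u \<in> {t s..<t (Suc s)}"
    moreover have "0 \<le> t s" "t (Suc s) \<le> 1"
      using t_mono[of 0 s] t_mono[of "Suc s" k] s t01 by auto
    ultimately have u: "u \<in> {0..<1}" "t s \<le> u" "u < t (Suc s)"
      by auto
    have "b u \<le> s"
      unfolding b_def by (rule Least_le) (rule u)
    moreover have "\<not> b u < s"
    proof
      assume "b u < s"
      then have "t (Suc (b u)) \<le> t s"
        using s by (intro t_mono) auto
      then show False
        using b(3)[OF u(1)] u(2) by simp
    qed
    ultimately show "u \<in> {u \<in> space unit_interval. b u = s}"
      using u(1) by (simp add: space_unit_interval)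
  qed (use b in \<open>auto simp: space_unit_interval\<close>)
  have bounds: "0 \<le> t s" "t s \<le> t (Suc s)" "t (Suc s) \<le> 1" if "s < k" for s
    using t_mono[of 0 s] t_mono[of s "Suc s"] t_mono[of "Suc s" k] that t01 by auto
  show thesis
  proof
    show "b \<in> unit_interval \<rightarrow>\<^sub>M count_space {..<k}"
    proof (subst measurable_count_space_eq2)
      show "b \<in> space unit_interval \<rightarrow> {..<k} \<and> (\<forall>s\<in>{..<k}. b -` {s} \<inter> space unit_interval \<in> sets unit_interval)"
      proof (intro conjI ballI)
        show "b \<in> space unit_interval \<rightarrow> {..<k}"
          using b by (auto simp: space_unit_interval)
        fix s assume "s \<in> {..<k}"
        then have s: "s < k"
          by simp
        have "b -` {s} \<inter> space unit_interval = {u \<in> space unit_interval. b u = s}"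
          by auto
        then show "b -` {s} \<inter> space unit_interval \<in> sets unit_interval"
          unfolding fibre[OF s] using bounds[OF s] by (simp add: sets_unit_interval)
      qed
    qed simp
    show "emeasure unit_interval {u \<in> space unit_interval. b u = s} = ennreal (l s)" if "s < k" for s
      unfolding fibre[OF that] using bounds[OF that] by (simp add: emeasure_unit_interval) (simp add: t_def)
    show "real (b u) \<le> real (b v) + 1 + \<bar>u - v\<bar> / \<kappa>" if u: "u \<in> {0..<1}" and v: "v \<in> {0..<1}" for u v
    proof (cases "b v < b u")
      case True
      then have "real (b u - Suc (b v)) * \<kappa> \<le> t (b u) - t (Suc (b v))"
        using b(1)[OF u] by (intro gap) auto
      also have "\<dots> \<le> \<bar>u - v\<bar>"
        using b(2)[OF u] b(3)[OF v] by linarith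
      finally have "real (b u - Suc (b v)) \<le> \<bar>u - v\<bar> / \<kappa>"
        using \<open>\<kappa> > 0\<close> by (simp add: field_simps)
      then show ?thesis
        using True by (simp add: of_nat_diff)
    next
      case False
      moreover have "0 \<le> \<bar>u - v\<bar> / \<kappa>"
        using \<open>\<kappa> > 0\<close> by simp
      ultimately show ?thesis
        by linarith
    qed
  qed
qed

text \<open>The fibres of rounding down are half-open intervals of length \<open>1 / n\<close>. The
  map lets a uniform grid of any fineness stand in for the interval.\<close>

lemma interval_grid:
  assumes "n > 0"
  defines "a \<equiv> \<lambda>u. nat \<lfloor>real n * u\<rfloor>"
  shows "a \<in> unit_interval \<rightarrow>\<^sub>M uniform_count_measure {..<n}"
    and "distr unit_interval (uniform_count_measure {..<n}) a = uniform_count_measure {..<n}"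
    and "\<And>u. u \<in> {0..<1} \<Longrightarrow> a u < n \<and> \<bar>u - real (a u) / n\<bar> \<le> 1 / n"
proof -
  have fl: "real (a u) \<le> real n * u" "real n * u < real (a u) + 1" "a u < n" if "u \<in> {0..<1}" for u
  proof -
    have "0 \<le> real n * u" "real n * u < real n"
      using that assms(1) by auto
    then show "real (a u) \<le> real n * u" "real n * u < real (a u) + 1"
      unfolding a_def by linarith+
    then show "a u < n"
      using \<open>real n * u < real n\<close> by linarith
  qed
  show "a u < n \<and> \<bar>u - real (a u) / n\<bar> \<le> 1 / n" if "u \<in> {0..<1}" for u
  proof -
    have "real n * (u - real (a u) / n) = n * u - a u"
      using assms(1) by (simp add: right_diff_distrib)
    then have "\<bar>real n * (u - real (a u) / n)\<bar> \<le> 1"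
      using fl[OF that] by linarith
    then have "real n * \<bar>u - real (a u) / n\<bar> \<le> 1"
      by (simp add: abs_mult)
    then show ?thesis
      using fl(3)[OF that] assms(1) by (simp add: mult.commute pos_le_divide_eq)
  qed
  have fibre: "a -` {s} \<inter> space unit_interval = {real s / n..<real (Suc s) / n}" if "s < n" for s
  proof (intro set_eqI iffI)
    fix u assume "u \<in> a -` {s} \<inter> space unit_interval"
    then show "u \<in> {real s / n..<real (Suc s) / n}"
      using fl[of u] assms(1) by (auto simp: space_unit_interval field_simps)
  next
    fix u assume "u \<in> {real s / n..<real (Suc s) / n}"
    then have u: "real s \<le> real n * u" "real n * u < real s + 1"
      using assms(1) by (auto simp: field_simps)
    then have "0 \<le> real n * u" "real n * u < real n"
      using that by linarith+
    then have "u \<in> {0..<1}"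
      using assms(1) by (auto simp: zero_le_mult_iff)
    moreover have "a u = s"
      unfolding a_def using u by linarith
    ultimately show "u \<in> a -` {s} \<inter> space unit_interval"
      by (simp add: space_unit_interval)
  qed
  have bounds: "0 \<le> real s / n" "real (Suc s) / n \<le> 1" "real s / n \<le> real (Suc s) / n" if "s < n" for s
    using that assms(1) by (auto simp: field_simps)
  have "a \<in> unit_interval \<rightarrow>\<^sub>M count_space {..<n}"
  proof (subst measurable_count_space_eq2)
    show "a \<in> space unit_interval \<rightarrow> {..<n} \<and> (\<forall>s\<in>{..<n}. a -` {s} \<inter> space unit_interval \<in> sets unit_interval)"
      using fl bounds by (auto simp: space_unit_interval fibre[unfolded space_unit_interval] intro!: sets_unit_interval)
  qed simp
  then show meas: "a \<in> unit_interval \<rightarrow>\<^sub>M uniform_count_measure {..<n}"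
    by (simp cong: measurable_cong_sets add: sets_uniform_count_measure_count_space)
  show "distr unit_interval (uniform_count_measure {..<n}) a = uniform_count_measure {..<n}"
  proof (rule measure_eqI_finite[of _ "{..<n}"])
    fix s assume "s \<in> {..<n}"
    then have s: "s < n"
      by simp
    have "emeasure (distr unit_interval (uniform_count_measure {..<n}) a) {s}
        = emeasure unit_interval {real s / n..<real (Suc s) / n}"
      using s by (subst emeasure_distr[OF meas]) (auto simp: fibre sets_uniform_count_measure)
    also have "\<dots> = ennreal (1 / n)"
      using bounds[OF s] by (subst emeasure_unit_interval) (auto simp: add_divide_distrib)
    also have "\<dots> = emeasure (uniform_count_measure {..<n}) {s}"
      using s by (simp add: emeasure_uniform_count_measure)
    finally show "emeasure (distr unit_interval (uniform_count_measure {..<n}) a) {s}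
        = emeasure (uniform_count_measure {..<n}) {s}" .
  qed (auto simp: sets_uniform_count_measure)
qed

subsection \<open>Finite nets\<close>

text \<open>Taking the first close point in list order resolves ties by finitely many tests on
  balls, which makes the choice measurable. The value \<open>z0\<close> is used where no point of
  the list is close.\<close>

definition first_near :: "real \<Rightarrow> 'a::metric_space list \<Rightarrow> 'a \<Rightarrow> 'a \<Rightarrow> 'a" where
  "first_near \<delta> zs z0 = foldr (\<lambda>z h x. if dist x z < \<delta> then z else h x) zs (\<lambda>_. z0)"

lemma first_near_simps:
  "first_near \<delta> [] z0 x = z0"
  "first_near \<delta> (z # zs) z0 x = (if dist x z < \<delta> then z else first_near \<delta> zs z0 x)"
  by (simp_all add: first_near_def)

lemma first_near_in: "first_near \<delta> zs z0 x \<in> insert z0 (set zs)"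
  by (induction zs) (auto simp: first_near_simps)

lemma dist_first_near: "z \<in> set zs \<Longrightarrow> dist x z < \<delta> \<Longrightarrow> dist x (first_near \<delta> zs z0 x) < \<delta>"
  by (induction zs) (auto simp: first_near_simps)

lemma measurable_first_near:
  fixes M :: "'a::metric_space measure"
  assumes "sets M = sets borel" "insert z0 (set zs) \<subseteq> Z"
  shows "first_near \<delta> zs z0 \<in> M \<rightarrow>\<^sub>M count_space Z"
  using assms(2)
proof (induction zs)
  case Nil
  then show ?case
    by (simp add: first_near_def)
next
  case (Cons z zs)
  have "{x \<in> space M. dist x z < \<delta>} = ball z \<delta>"
    using sets_eq_imp_space_eq[OF assms(1)] by (auto simp: dist_commute)
  then have [measurable]: "Measurable.pred M (\<lambda>x. dist x z < \<delta>)"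
    by (simp add: pred_def assms(1))
  have [measurable]: "first_near \<delta> zs z0 \<in> M \<rightarrow>\<^sub>M count_space Z"
    using Cons by simp
  have "(\<lambda>x. if dist x z < \<delta> then z else first_near \<delta> zs z0 x) \<in> M \<rightarrow>\<^sub>M count_space Z"
    using Cons.prems by (intro measurable_If) auto
  then show ?case
    by (simp add: first_near_simps(2) cong: measurable_cong)
qed

lemma compact_finite_net:
  fixes K :: "'a::metric_space set"
  assumes "compact K" "\<delta> > 0"
  obtains zs where "set zs \<subseteq> K" "\<And>x. x \<in> K \<Longrightarrow> \<exists>z\<in>set zs. dist x z < \<delta>"
proof -
  have "K \<subseteq> (\<Union>z\<in>K. ball z \<delta>)"
    using assms(2) by auto
  then obtain D where D: "D \<subseteq> K" "finite D" "K \<subseteq> (\<Union>z\<in>D. ball z \<delta>)"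
    by (rule compactE_image[OF assms(1), rotated]) auto
  obtain zs where "set zs = D"
    using finite_list[OF D(2)] by blast
  with D show thesis
    by (intro that[of zs]) (force simp: dist_commute)+
qed

lemma measurable_finite_valued:
  assumes "finite I" "finite Z"
  shows "f \<in> borel_measurable (PiM I (\<lambda>_. count_space Z))"
  using assms by (subst count_space_PiM_finite) (auto intro: countable_finite)

text \<open>\<open>f\<close> is a uniform limit of its compositions with coordinatewise rounding to
  finite nets. Each composition factors through a finite discrete product, so it is measurable for
  the product sigma-algebra and takes finitely many values; the latter yields the bound.\<close>

lemma uniformly_continuous_product_measurable:
  fixes f :: "('i \<Rightarrow> 'a::metric_space) \<Rightarrow> real" and M :: "'a measure"
  assumes M: "sets M = sets borel" and K: "compact (UNIV :: 'a set)" and I: "finite I"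
    and f: "\<And>\<eta>. \<eta> > 0 \<Longrightarrow> \<exists>\<delta>>0. \<forall>x y. x \<in> PiE I (\<lambda>_. UNIV) \<longrightarrow> y \<in> PiE I (\<lambda>_. UNIV) \<longrightarrow>
        (\<forall>i\<in>I. dist (x i) (y i) \<le> \<delta>) \<longrightarrow> \<bar>f x - f y\<bar> \<le> \<eta>"
  shows "f \<in> borel_measurable (PiM I (\<lambda>_. M))"
    and "\<exists>B. \<forall>x\<in>PiE I (\<lambda>_. UNIV). \<bar>f x\<bar> \<le> B"
proof -
  have space: "space (PiM I (\<lambda>_. M)) = PiE I (\<lambda>_. UNIV)"
    using sets_eq_imp_space_eq[OF M] by (simp add: space_PiM)
  have approx: "\<exists>Z r. finite Z \<and> r \<in> M \<rightarrow>\<^sub>M count_space Z \<and>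
      (\<forall>x\<in>PiE I (\<lambda>_. UNIV). \<bar>f x - f (compose I r x)\<bar> \<le> \<eta>)" if \<eta>: "\<eta> > 0" for \<eta>
  proof -
    obtain \<delta> where \<delta>: "\<delta> > 0" "\<And>x y. x \<in> PiE I (\<lambda>_. UNIV) \<Longrightarrow> y \<in> PiE I (\<lambda>_. UNIV) \<Longrightarrow>
        \<forall>i\<in>I. dist (x i) (y i) \<le> \<delta> \<Longrightarrow> \<bar>f x - f y\<bar> \<le> \<eta>"
      using f[OF \<eta>] by blast
    obtain zs :: "'a list" where zs: "\<And>x. \<exists>z\<in>set zs. dist x z < \<delta>"
      using compact_finite_net[OF K \<delta>(1)] by (metis UNIV_I)
    define r where "r = first_near \<delta> zs (hd zs)"
    have "dist x (r x) \<le> \<delta>" for x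
      using zs[of x] dist_first_near[of _ zs x \<delta> "hd zs"] unfolding r_def by force
    then have "\<forall>x\<in>PiE I (\<lambda>_. UNIV). \<bar>f x - f (compose I r x)\<bar> \<le> \<eta>"
      by (intro ballI \<delta>(2)) (auto simp: compose_def)
    moreover have "r \<in> M \<rightarrow>\<^sub>M count_space (insert (hd zs) (set zs))"
      unfolding r_def by (rule measurable_first_near[OF M]) simp
    ultimately show ?thesis
      by (intro exI[of _ "insert (hd zs) (set zs)"] exI[of _ r]) simp
  qed
  have "\<forall>m. \<exists>Z r. finite Z \<and> r \<in> M \<rightarrow>\<^sub>M count_space Z \<and>
      (\<forall>x\<in>PiE I (\<lambda>_. UNIV). \<bar>f x - f (compose I r x)\<bar> \<le> 1 / real (Suc m))"
    by (intro allI approx) simp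
  then obtain Z r where Zr: "\<And>m. finite (Z m)" "\<And>m. r m \<in> M \<rightarrow>\<^sub>M count_space (Z m)"
      "\<And>m x. x \<in> PiE I (\<lambda>_. UNIV) \<Longrightarrow> \<bar>f x - f (compose I (r m) x)\<bar> \<le> 1 / real (Suc m)"
    by metis
  show "f \<in> borel_measurable (PiM I (\<lambda>_. M))"
  proof (rule borel_measurable_LIMSEQ_real)
    show "(\<lambda>x. f (compose I (r m) x)) \<in> borel_measurable (PiM I (\<lambda>_. M))" for m
      by (rule measurable_compose[OF measurable_compose_restrict[OF Zr(2)] measurable_finite_valued[OF I Zr(1)]])
    fix x assume "x \<in> space (PiM I (\<lambda>_. M))"
    then have x: "x \<in> PiE I (\<lambda>_. UNIV)"
      by (simp add: space)
    show "(\<lambda>m. f (compose I (r m) x)) \<longlonglongrightarrow> f x"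
    proof (rule LIM_zero_cancel, rule Lim_null_comparison)
      show "\<forall>\<^sub>F m in sequentially. norm (f (compose I (r m) x) - f x) \<le> 1 / real (Suc m)"
        using Zr(3)[OF x] by (simp add: abs_minus_commute)
      show "(\<lambda>m. 1 / real (Suc m)) \<longlonglongrightarrow> 0"
        using LIMSEQ_inverse_real_of_nat by (simp add: inverse_eq_divide)
    qed
  qed
  have "\<bar>f x\<bar> \<le> Max ((\<lambda>z. \<bar>f z\<bar>) ` PiE I (\<lambda>_. Z 0)) + 1" if x: "x \<in> PiE I (\<lambda>_. UNIV)" for x
  proof -
    have "compose I (r 0) x \<in> PiE I (\<lambda>_. Z 0)"
      using measurable_space[OF Zr(2)] sets_eq_imp_space_eq[OF M] by (auto simp: compose_def)
    then have "\<bar>f (compose I (r 0) x)\<bar> \<le> Max ((\<lambda>z. \<bar>f z\<bar>) ` PiE I (\<lambda>_. Z 0))"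
      using I Zr(1) by (intro Max_ge) (auto simp: finite_PiE)
    then show ?thesis
      using Zr(3)[OF x, of 0] by simp
  qed
  then show "\<exists>B. \<forall>x\<in>PiE I (\<lambda>_. UNIV). \<bar>f x\<bar> \<le> B"
    by blast
qed

section \<open>The complement of the support\<close>

lemma Compl_spt: "- spt \<mu> = \<Union>{U. open U \<and> emeasure \<mu> U = 0}"
  by (auto simp: spt_def not_less)

lemma open_Compl_spt: "open (- spt \<mu>)"
  unfolding Compl_spt by auto

text \<open>By compactness, finitely many of the null open sets that make up the complement of the
  support already cover \<open>C\<close>.\<close>

lemma null_sets_off_spt:
  fixes \<mu> :: "'a::metric_space measure"
  assumes "sets \<mu> = sets borel" "compact C" "C \<inter> spt \<mu> = {}"
  shows "C \<in> null_sets \<mu>"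
proof -
  have "C \<subseteq> \<Union>{U. open U \<and> emeasure \<mu> U = 0}"
    using assms(3) unfolding Compl_spt[symmetric] by auto
  then obtain D where D: "D \<subseteq> {U. open U \<and> emeasure \<mu> U = 0}" "finite D" "C \<subseteq> \<Union>D"
    by (rule compactE[OF assms(2)]) auto
  have "\<Union>D \<in> null_sets \<mu>"
    using D(1,2) assms(1) by (intro null_sets.finite_Union) (auto simp: null_sets_def)
  moreover have "C \<in> sets \<mu>"
    using assms(1,2) by (simp add: borel_compact)
  ultimately show ?thesis
    using D(3) by (rule null_sets_subset)
qed

subsection \<open>Discretising the measure\<close>

text \<open>Rounding to a net of the support may fail on a null set, and some net points may receive
  no mass. Both defects are confined to a null set \<open>B\<close>, and \<open>\<rho>\<close> sends
  \<open>B\<close> to one good point: it preserves \<open>\<mu>\<close>, and its values all round to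
  a close net point of positive mass.\<close>

lemma spt_discretization:
  fixes \<mu> :: "'a::metric_space measure"
  assumes "metric_prob_space \<mu>" "\<delta> > 0"
  obtains Z \<rho> r where "finite Z" "Z \<noteq> {}" "Z \<subseteq> spt \<mu>"
    "\<And>y. y \<in> spt \<mu> \<Longrightarrow> \<exists>z\<in>Z. dist y z < 3 * \<delta>"
    "\<rho> \<in> \<mu> \<rightarrow>\<^sub>M \<mu>" "distr \<mu> \<mu> \<rho> = \<mu>" "r \<in> \<mu> \<rightarrow>\<^sub>M count_space Z"
    "\<And>x. dist (\<rho> x) (r x) < 2 * \<delta>"
    "\<And>z. z \<in> Z \<Longrightarrow> emeasure \<mu> {x. r x = z} > 0"
proof -
  have K: "compact (UNIV :: 'a set)" and prob: "prob_space \<mu>" and sets: "sets \<mu> = sets borel"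
    using assms(1) by (auto simp: metric_prob_space_def)
  interpret prob_space \<mu> by fact
  have space: "space \<mu> = UNIV"
    using sets_eq_imp_space_eq[OF sets] by simp
  have compact_closed: "compact C" if "closed C" for C :: "'a set"
    using compact_Int_closed[OF K that] by simp
  have "closed (spt \<mu>)"
    using open_Compl_spt by (simp add: closed_def)
  then obtain zs where zs: "set zs \<subseteq> spt \<mu>" "\<And>x. x \<in> spt \<mu> \<Longrightarrow> \<exists>z\<in>set zs. dist x z < \<delta>"
    by (rule compact_finite_net[OF compact_closed \<open>\<delta> > 0\<close>]) (rule that; blast)
  \<comment> \<open>The points far from the net form a compact set that misses the support, hence a
    null set.\<close>
  define D where "D = - (\<Union>z\<in>set zs. ball z (2 * \<delta>))"
  have D: "D \<in> null_sets \<mu>"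
  proof (rule null_sets_off_spt[OF sets compact_closed])
    show "closed D"
      unfolding D_def by (intro closed_Compl open_UN ballI open_ball)
    show "D \<inter> spt \<mu> = {}"
      unfolding D_def using zs(2) \<open>\<delta> > 0\<close> by (force simp: dist_commute)
  qed
  define z0 where "z0 = hd zs"
  define r0 where "r0 = first_near (2 * \<delta>) zs z0"
  define Z0 where "Z0 = insert z0 (set zs)"
  define Z where "Z = {z \<in> Z0. emeasure \<mu> {x. r0 x = z} > 0}"
  have r0_meas: "r0 \<in> \<mu> \<rightarrow>\<^sub>M count_space Z0"
    unfolding r0_def Z0_def by (rule measurable_first_near[OF sets]) simp
  have r0_in: "r0 x \<in> Z0" for x
    using first_near_in by (simp add: r0_def Z0_def)
  have fibre_sets: "{x. r0 x = z} \<in> sets \<mu>" for z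
  proof -
    have "{x. r0 x = z} = r0 -` ({z} \<inter> Z0) \<inter> space \<mu>"
      using r0_in space by auto
    then show ?thesis
      using measurable_sets[OF r0_meas, of "{z} \<inter> Z0"] by simp
  qed
  define B where "B = D \<union> (\<Union>z\<in>Z0 - Z. {x. r0 x = z})"
  have B: "B \<in> null_sets \<mu>"
    unfolding B_def
  proof (intro null_sets.Un D null_sets_UN')
    show "countable (Z0 - Z)"
      by (simp add: Z0_def countable_finite)
    show "{x. r0 x = z} \<in> null_sets \<mu>" if "z \<in> Z0 - Z" for z
      using that fibre_sets by (auto simp: Z_def null_sets_def not_less)
  qed
  have null_complement: "\<exists>x. x \<in> A \<and> x \<notin> B" if "emeasure \<mu> A > 0" "A \<in> sets \<mu>" for A
  proof (rule ccontr)
    assume "\<not> ?thesis"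
    then have "A \<subseteq> B" by auto
    then have "A \<in> null_sets \<mu>"
      using B that(2) null_sets_subset by blast
    then show False
      using that(1) by auto
  qed
  obtain x1 where x1: "x1 \<notin> B"
    using null_complement[of UNIV] emeasure_space_1 space sets by auto
  define \<rho> where "\<rho> x = (if x \<in> B then x1 else x)" for x
  define r where "r x = r0 (\<rho> x)" for x
  have \<rho>_B: "\<rho> x \<notin> B" for x
    using x1 by (simp add: \<rho>_def)
  have near: "dist x (r0 x) < 2 * \<delta> \<and> r0 x \<in> Z" if "x \<notin> B" for x
  proof
    have "x \<notin> D"
      using that by (simp add: B_def)
    then obtain z where "z \<in> set zs" "dist x z < 2 * \<delta>"
      by (auto simp: D_def dist_commute)
    then show "dist x (r0 x) < 2 * \<delta>"
      unfolding r0_def by (rule dist_first_near)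
    show "r0 x \<in> Z"
      using that r0_in[of x] by (auto simp: B_def)
  qed
  have Bs [measurable]: "B \<in> sets \<mu>"
    using B by auto
  have \<rho>_meas: "\<rho> \<in> \<mu> \<rightarrow>\<^sub>M \<mu>"
    unfolding \<rho>_def using space by (intro measurable_If measurable_const) auto
  have "AE x in \<mu>. \<rho> x = x"
    using AE_not_in[OF B] by eventually_elim (simp add: \<rho>_def)
  then have \<rho>_distr: "distr \<mu> \<mu> \<rho> = \<mu>"
    using distr_cong_AE[of \<mu> \<mu> \<mu> \<mu> \<rho> "\<lambda>x. x"] \<rho>_meas by (simp add: distr_id2)
  have Z0_spt: "Z0 \<subseteq> spt \<mu>"
  proof -
    have "zs \<noteq> []"
    proof
      assume "zs = []"
      then have "UNIV \<in> null_sets \<mu>"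
        using D by (simp add: D_def)
      then show False
        using emeasure_space_1 space by auto
    qed
    then show ?thesis
      using zs(1) by (auto simp: Z0_def z0_def)
  qed
  show thesis
  proof
    show "finite Z" "Z \<subseteq> spt \<mu>"
      using Z0_spt by (auto simp: Z_def Z0_def)
    show "Z \<noteq> {}"
      using near[OF x1] by auto
    show "\<rho> \<in> \<mu> \<rightarrow>\<^sub>M \<mu>" "distr \<mu> \<mu> \<rho> = \<mu>"
      by (fact \<rho>_meas \<rho>_distr)+
    show "dist (\<rho> x) (r x) < 2 * \<delta>" for x
      unfolding r_def using near[OF \<rho>_B] by simp
    have "r \<in> \<mu> \<rightarrow>\<^sub>M count_space Z0"
      unfolding r_def using measurable_compose[OF \<rho>_meas r0_meas] .
    then have "r \<in> \<mu> \<rightarrow>\<^sub>M restrict_space (count_space Z0) Z"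
      using near[OF \<rho>_B] by (intro measurable_restrict_space2) (auto simp: r_def)
    moreover have "Z \<inter> Z0 = Z"
      by (auto simp: Z_def)
    ultimately show "r \<in> \<mu> \<rightarrow>\<^sub>M count_space Z"
      by (simp add: restrict_count_space)
    show "\<exists>z\<in>Z. dist y z < 3 * \<delta>" if "y \<in> spt \<mu>" for y
    proof -
      \<comment> \<open>A support point may itself lie in \<open>B\<close>, but its
        \<open>\<delta>\<close>-ball has positive measure and so contains a point \<open>x\<close>
        outside \<open>B\<close>. The radius \<open>3 * \<delta>\<close> is \<open>\<delta>\<close>
        to reach \<open>x\<close> plus \<open>2 * \<delta>\<close> to round it.\<close>
      have "emeasure \<mu> (ball y \<delta>) > 0"
        using that \<open>\<delta> > 0\<close> by (auto simp: spt_def)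
      then obtain x where x: "dist y x < \<delta>" "x \<notin> B"
        using null_complement[of "ball y \<delta>"] sets by auto
      then show ?thesis
        using near[OF x(2)] dist_triangle[of y "r0 x" x] by (intro bexI[of _ "r0 x"]) auto
    qed
    show "emeasure \<mu> {x. r x = z} > 0" if "z \<in> Z" for z
    proof -
      have "0 < emeasure \<mu> {x. r0 x = z}"
        using that by (simp add: Z_def)
      \<comment> \<open>Off \<open>B\<close> the map \<open>\<rho>\<close> is the identity, and
        discarding the null set \<open>B\<close> loses no mass.\<close>
      also have "\<dots> = emeasure \<mu> ({x. r0 x = z} - B)"
        by (rule emeasure_Diff_null_set[OF B fibre_sets, symmetric])
      also have "\<dots> \<le> emeasure \<mu> {x. r x = z}"
      proof (rule emeasure_mono)
        show "{x. r0 x = z} - B \<subseteq> {x. r x = z}"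
          by (auto simp: r_def \<rho>_def)
        have "{x. r x = z} = \<rho> -` {x. r0 x = z} \<inter> space \<mu>"
          using space by (auto simp: r_def)
        then show "{x. r x = z} \<in> sets \<mu>"
          using measurable_sets[OF \<rho>_meas fibre_sets[of z]] by simp
      qed
      finally show ?thesis .
    qed
  qed
qed

text \<open>The discretised measure is the law of a random point on a walk through the net: the mass of
  a net point is shared equally among the times at which the walk visits it, so that every time
  gets positive mass.\<close>

lemma interval_walk_model:
  fixes \<mu> :: "'a::metric_space measure"
  assumes "metric_prob_space \<mu>" "connected (spt \<mu>)" "\<delta> > 0"
  obtains Z \<rho> r w b \<kappa> where "finite Z"
    "\<rho> \<in> \<mu> \<rightarrow>\<^sub>M \<mu>" "distr \<mu> \<mu> \<rho> = \<mu>" "r \<in> \<mu> \<rightarrow>\<^sub>M count_space Z"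
    "\<And>x. dist (\<rho> x) (r x) < 2 * \<delta>"
    "\<And>s :: nat. dist (w s) (w (Suc s)) < 6 * \<delta>"
    "(\<lambda>u. w (b u)) \<in> unit_interval \<rightarrow>\<^sub>M count_space Z"
    "distr unit_interval (count_space Z) (\<lambda>u. w (b u)) = distr \<mu> (count_space Z) r"
    "\<kappa> > 0"
    "\<And>u v. u \<in> {0..<1} \<Longrightarrow> v \<in> {0..<1} \<Longrightarrow> real (b u) \<le> real (b v) + 1 + \<bar>u - v\<bar> / \<kappa>"
proof (rule spt_discretization[OF assms(1,3)])
  fix Z \<rho> r
  assume Z: "finite Z" "Z \<noteq> {}" "Z \<subseteq> spt \<mu>"
    "\<And>y. y \<in> spt \<mu> \<Longrightarrow> \<exists>z\<in>Z. dist y z < 3 * \<delta>"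
    and \<rho>: "\<rho> \<in> \<mu> \<rightarrow>\<^sub>M \<mu>" "distr \<mu> \<mu> \<rho> = \<mu>" and r: "r \<in> \<mu> \<rightarrow>\<^sub>M count_space Z"
    "\<And>x. dist (\<rho> x) (r x) < 2 * \<delta>"
    "\<And>z. z \<in> Z \<Longrightarrow> emeasure \<mu> {x. r x = z} > 0"
  have sets: "sets \<mu> = sets borel"
    using assms(1) by (auto simp: metric_prob_space_def)
  interpret prob_space \<mu>
    using assms(1) by (simp add: metric_prob_space_def)
  have space: "space \<mu> = UNIV"
    using sets_eq_imp_space_eq[OF sets] by simp
  \<comment> \<open>The length \<open>6 * \<delta>\<close> is twice the net radius
    \<open>3 * \<delta>\<close>.\<close>
  have "(x, y) \<in> {(x, y). x \<in> Z \<and> y \<in> Z \<and> dist x y < 6 * \<delta>}\<^sup>*" if "x \<in> Z" "y \<in> Z" for x y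
    using connected_net_chains[OF assms(2) Z(3,4) that] by simp
  then obtain w :: "nat \<Rightarrow> 'a" and k where w: "w ` {..<k} = Z" "\<And>s. dist (w s) (w (Suc s)) < 6 * \<delta>"
    using assms(3) by (elim covering_walk[OF Z(1,2), of "6 * \<delta>", rotated 2]) auto
  define p where "p z = prob {x. r x = z}" for z
  define visits where "visits z = {s \<in> {..<k}. w s = z}" for z
  define l where "l s = p (w s) / card (visits (w s))" for s
  have visits: "finite (visits z)" for z
    by (simp add: visits_def)
  have visits_ne: "visits z \<noteq> {}" if "z \<in> Z" for z
    using that w(1) by (auto simp: visits_def)
  have p: "p z > 0" "emeasure \<mu> {x. r x = z} = ennreal (p z)" if "z \<in> Z" for z
    using r(3)[OF that] by (simp_all add: p_def emeasure_eq_measure)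
  have wZ: "w s \<in> Z" if "s < k" for s
    using that w(1) by auto
  have l_pos: "l s > 0" if "s < k" for s
    using that p(1)[OF wZ] visits visits_ne[OF wZ] by (simp add: l_def card_gt_0_iff)
  have l_visits: "(\<Sum>s\<in>visits z. l s) = p z" if "z \<in> Z" for z
  proof -
    have "(\<Sum>s\<in>visits z. l s) = (\<Sum>s\<in>visits z. p z / card (visits z))"
      by (intro sum.cong) (auto simp: l_def visits_def)
    then show ?thesis
      using visits_ne[OF that] visits[of z] by simp
  qed
  have rs: "{x. r x = z} \<in> sets \<mu>" if "z \<in> Z" for z
    using measurable_sets[OF r(1), of "{z}"] that space by (simp add: vimage_def)
  have "(\<Sum>z\<in>Z. p z) = prob (\<Union>z\<in>Z. {x. r x = z})"
    unfolding p_def using Z(1) rs by (intro finite_measure_finite_Union[symmetric]) (auto simp: disjoint_family_on_def)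
  also have "(\<Union>z\<in>Z. {x. r x = z}) = space \<mu>"
    using measurable_space[OF r(1)] space by auto
  finally have sum_p: "(\<Sum>z\<in>Z. p z) = 1"
    by (simp add: prob_space)
  have "(\<Sum>s<k. l s) = (\<Sum>z\<in>Z. \<Sum>s\<in>visits z. l s)"
    unfolding visits_def using w(1) Z(1) by (intro sum.group[symmetric]) auto
  also have "\<dots> = 1"
    using l_visits sum_p by simp
  finally have sum_l: "(\<Sum>s<k. l s) = 1" .
  have k: "k > 0"
    using w(1) Z(2) by (cases k) auto
  \<comment> \<open>The least mass of a time of the walk. It depends only on the measure and the
    discretisation, not on any number of coordinates.\<close>
  define \<kappa> where "\<kappa> = Min (l ` {..<k})"
  have \<kappa>: "\<kappa> > 0" "\<And>s. s < k \<Longrightarrow> \<kappa> \<le> l s"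
  proof -
    have "l ` {..<k} \<noteq> {}"
      using k by auto
    then show "\<kappa> > 0" "\<And>s. s < k \<Longrightarrow> \<kappa> \<le> l s"
      unfolding \<kappa>_def using l_pos by (subst Min_gr_iff, auto)
  qed
  show thesis
  proof (rule interval_blocks[OF k \<kappa>(2,1) sum_l])
    fix b
    assume b: "b \<in> unit_interval \<rightarrow>\<^sub>M count_space {..<k}"
      "\<And>s. s < k \<Longrightarrow> emeasure unit_interval {u \<in> space unit_interval. b u = s} = ennreal (l s)"
      "\<And>u v. u \<in> {0..<1} \<Longrightarrow> v \<in> {0..<1} \<Longrightarrow> real (b u) \<le> real (b v) + 1 + \<bar>u - v\<bar> / \<kappa>"
    have "w \<in> count_space {..<k} \<rightarrow>\<^sub>M count_space Z"
      using wZ by auto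
    then have wb: "(\<lambda>u. w (b u)) \<in> unit_interval \<rightarrow>\<^sub>M count_space Z"
      using b(1) by (rule measurable_compose[rotated])
    have "distr unit_interval (count_space Z) (\<lambda>u. w (b u)) = distr \<mu> (count_space Z) r"
    proof (rule measure_eqI_finite[of _ Z])
      fix z assume z: "z \<in> Z"
      have "emeasure (distr unit_interval (count_space Z) (\<lambda>u. w (b u))) {z}
          = emeasure unit_interval (\<Union>s\<in>visits z. {u \<in> space unit_interval. b u = s})"
        using z measurable_space[OF b(1)]
        by (subst emeasure_distr[OF wb]) (auto simp: visits_def intro!: arg_cong[where f = "emeasure unit_interval"])
      also have "\<dots> = (\<Sum>s\<in>visits z. emeasure unit_interval {u \<in> space unit_interval. b u = s})"
      proof (rule sum_emeasure[symmetric])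
        show "(\<lambda>s. {u \<in> space unit_interval. b u = s}) ` visits z \<subseteq> sets unit_interval"
        proof safe
          fix s assume "s \<in> visits z"
          then show "{u \<in> space unit_interval. b u = s} \<in> sets unit_interval"
            using measurable_sets[OF b(1), of "{s}"] by (simp add: visits_def vimage_def Collect_conj_eq Int_commute)
        qed
      qed (auto simp: visits disjoint_family_on_def)
      also have "\<dots> = (\<Sum>s\<in>visits z. ennreal (l s))"
        using b(2) by (intro sum.cong) (auto simp: visits_def)
      also have "\<dots> = ennreal (p z)"
        using l_pos l_visits[OF z] by (subst sum_ennreal) (auto simp: visits_def less_imp_le)
      also have "\<dots> = emeasure (distr \<mu> (count_space Z) r) {z}"
        using z p(2)[OF z] space by (subst emeasure_distr[OF r(1)]) (auto simp: vimage_def)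
      finally show "emeasure (distr unit_interval (count_space Z) (\<lambda>u. w (b u))) {z}
          = emeasure (distr \<mu> (count_space Z) r) {z}" .
    qed (auto simp: Z(1))
    from that[OF Z(1) \<rho> r(1,2) w(2) wb this \<kappa>(1) b(3)] show thesis .
  qed
qed

subsection \<open>Uniform juntas\<close>

lemma modulus_of_continuityD:
  assumes "modulus_of_continuity Y \<rho> f r \<le> c" "x \<in> Y" "y \<in> Y" "\<rho> x y \<le> r"
  shows "ennreal \<bar>f x - f y\<bar> \<le> c"
proof -
  have "ennreal \<bar>f x - f y\<bar> \<le> modulus_of_continuity Y \<rho> f r"
    unfolding modulus_of_continuity_def using assms(2-4) by (intro Sup_upper) blast
  then show ?thesis
    using assms(1) by (rule order_trans)
qed

lemma dist_inf_le:
  assumes "N \<ge> 1" "\<And>i. i \<in> {1..N} \<Longrightarrow> dist (x i) (y i) \<le> r"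
  shows "dist_inf N x y \<le> r"
  unfolding dist_inf_def using assms by (subst Max_le_iff) auto

text \<open>The function on the interval and its smoothed version on the grid differ by at most
  \<open>4 * \<eta>\<close>: \<open>2 * \<eta>\<close> for moving a point to the grid and
  \<open>2 * \<eta>\<close> for the smoothing. This is doubled to \<open>8 * \<eta>\<close> because
  the averages change too. The bound \<open>L\<close> does not involve the size of \<open>I\<close>,
  although the grid used in the proof does.\<close>

lemma uniform_grid_junta:
  fixes F :: "('i \<Rightarrow> nat) \<Rightarrow> real" and b :: "real \<Rightarrow> nat" and \<eta> \<kappa> \<delta> L :: real
  assumes I: "finite I" "I \<noteq> {}" and "\<eta> > 0" "\<kappa> > 0" "\<delta> > 0"
    and F: "\<And>x y. adjacent_on I x y \<Longrightarrow> \<bar>F x - F y\<bar> \<le> \<eta>"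
    and b: "\<And>u v. u \<in> {0..<1} \<Longrightarrow> v \<in> {0..<1} \<Longrightarrow> real (b u) \<le> real (b v) + 1 + \<bar>u - v\<bar> / \<kappa>"
    and meas: "(\<lambda>u. F (compose I b u)) \<in> borel_measurable (PiM I (\<lambda>_. unit_interval))"
    and bounded: "\<And>u. u \<in> space (PiM I (\<lambda>_. unit_interval)) \<Longrightarrow> \<bar>F (compose I b u)\<bar> \<le> B"
  defines "L \<equiv> 6 * \<eta> / \<kappa>"
  shows "\<exists>S\<subseteq>I. \<delta> * card S \<le> L \<and> junta_error unit_interval I (I - S) (\<lambda>u. F (compose I b u))
    \<le> ennreal (sqrt (L\<^sup>2 / (real d + 1) + 3 ^ d * (L * sqrt (L * \<delta>))) + 8 * \<eta>)"
proof -
  \<comment> \<open>The grid is made so fine that box averaging, which costs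
    \<open>card I * l\<close>, costs at most \<open>\<eta>\<close>.\<close>
  obtain M :: nat where "card I / \<kappa> < 2 ^ M"
    using real_arch_pow[of 2] by auto
  define n :: nat where "n = 2 ^ M"
  have n: "n > 0" "card I < n * \<kappa>"
    using \<open>card I / \<kappa> < 2 ^ M\<close> \<open>\<kappa> > 0\<close> by (simp_all add: n_def field_simps)
  \<comment> \<open>A distance \<open>r\<close> in the interval costs
    \<open>\<eta> / \<kappa> * r\<close> beyond the additive \<open>\<eta>\<close>, and one step of
    the grid has length \<open>1 / n\<close>.\<close>
  define l where "l = \<eta> / (n * \<kappa>)"
  have cardI: "card I \<ge> 1"
    using I by (simp add: Suc_le_eq card_gt_0_iff)
  have l: "0 < l" "card I * l \<le> \<eta>" "6 * l * 2 ^ M = L"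
    using n \<open>\<eta> > 0\<close> \<open>\<kappa> > 0\<close> by (auto simp: l_def L_def n_def field_simps)
  define Y where "Y = PiE I (\<lambda>_. {..<n})"
  define c where "c x = compose I b (\<lambda>i. real (x i) / n)" for x :: "'i \<Rightarrow> nat"
  have point: "real m / n \<in> {0..<1}" if "m < n" for m
    using that by simp
  have chain: "F (compose I b u) - F (compose I b v) \<le> \<eta> + \<eta> / \<kappa> * r"
    if u: "\<And>i. i \<in> I \<Longrightarrow> u i \<in> {0..<1}" and v: "\<And>i. i \<in> I \<Longrightarrow> v i \<in> {0..<1}"
      and r: "\<And>i. i \<in> I \<Longrightarrow> \<bar>u i - v i\<bar> \<le> r" for u v r
  proof -
    \<comment> \<open>A bound for the number of walk steps between coordinates at distance
      \<open>r\<close>; rounding down is allowed because times are integers.\<close>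
    define m where "m = nat \<lfloor>1 + r / \<kappa>\<rfloor>"
    obtain i where "i \<in> I"
      using I by auto
    then have "0 \<le> r"
      using r[of i] by simp
    then have r0: "0 \<le> r / \<kappa>"
      using \<open>\<kappa> > 0\<close> by simp
    then have m: "m \<ge> 1" "real m \<le> 1 + r / \<kappa>" "1 + r / \<kappa> < real m + 1"
      unfolding m_def by linarith+
    have "\<bar>F (compose I b u) - F (compose I b v)\<bar> \<le> real m * \<eta>"
    proof (rule adjacent_chain_bound[OF F m(1)])
      fix i assume i: "i \<in> I"
      have "\<bar>u i - v i\<bar> / \<kappa> \<le> r / \<kappa>"
        using r[OF i] \<open>\<kappa> > 0\<close> by (simp add: divide_right_mono)
      then have "real (b (u i)) < real (b (v i)) + real m + 1" "real (b (v i)) < real (b (u i)) + real m + 1"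
        using b[OF u[OF i] v[OF i]] b[OF v[OF i] u[OF i]] m(3) by (simp_all add: abs_minus_commute)
      then show "compose I b u i \<le> compose I b v i + m \<and> compose I b v i \<le> compose I b u i + m"
        using i by (simp add: compose_def)
    qed
    also have "\<dots> \<le> (1 + r / \<kappa>) * \<eta>"
      using m(2) \<open>\<eta> > 0\<close> by (intro mult_right_mono) auto
    finally show ?thesis
      by (simp add: algebra_simps)
  qed
  obtain G where G: "\<And>x. (\<Sum>i\<in>I. \<bar>G (x(i := Suc (x i))) - G x\<bar>) \<le> 6 * l"
    "\<And>x. x \<in> Y \<Longrightarrow> \<bar>G x - F (c x)\<bar> \<le> \<eta> + card I * l"
  proof (rule Lipschitz_smoothing[OF I, of Y l \<eta> "\<lambda>x. F (c x)"])
    show "finite Y"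
      using I by (simp add: Y_def finite_PiE)
    show "Y \<noteq> {}"
      using n by (auto simp: Y_def PiE_eq_empty_iff)
    fix x y r assume x: "x \<in> Y" and y: "y \<in> Y" and r: "\<And>i. i \<in> I \<Longrightarrow> \<bar>real (x i) - real (y i)\<bar> \<le> r"
    have "F (c x) - F (c y) \<le> \<eta> + \<eta> / \<kappa> * (r / n)"
      unfolding c_def
    proof (rule chain)
      fix i assume i: "i \<in> I"
      show "real (x i) / n \<in> {0..<1}" "real (y i) / n \<in> {0..<1}"
        using x y i by (intro point; auto simp: Y_def)+
      show "\<bar>real (x i) / n - real (y i) / n\<bar> \<le> r / n"
        using r[OF i] n(1) by (simp add: divide_right_mono flip: diff_divide_distrib)
    qed
    then show "F (c x) - F (c y) \<le> \<eta> + l * r"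
      by (simp add: l_def mult.commute)
  next
    fix G
    assume "\<And>x. (\<Sum>i\<in>I. \<bar>G (x(i := Suc (x i))) - G x\<bar>) \<le> 6 * l"
      "\<And>x. x \<in> Y \<Longrightarrow> \<bar>G x - F (c x)\<bar> \<le> \<eta> + card I * l"
    then show thesis
      by (rule that)
  qed (use l \<open>\<eta> > 0\<close> in auto)
  obtain S where S: "S \<subseteq> I" "\<delta> * card S \<le> L"
    "grid_mean I n (\<lambda>x. (G x - grid_mean (I - S) n (\<lambda>y. G (merge_on (I - S) x y)))\<^sup>2)
      \<le> L\<^sup>2 / (real d + 1) + 3 ^ d * (L * sqrt (L * \<delta>))"
    using grid_junta[OF I(1) G(1) \<open>\<delta> > 0\<close>, of M d] unfolding l(3) n_def merge_on_def by blast
  define a where "a u = nat \<lfloor>real n * u\<rfloor>" for u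
  note a = interval_grid[OF n(1), folded a_def]
  let ?V = "L\<^sup>2 / (real d + 1) + 3 ^ d * (L * sqrt (L * \<delta>))"
  have GY: "G \<in> borel_measurable (PiM I (\<lambda>_. uniform_count_measure {..<n}))"
    unfolding PiM_uniform_count_measure[OF I(1) n(1)]
    by (simp cong: measurable_cong_sets add: sets_uniform_count_measure_count_space)
  have close: "\<bar>F (compose I b u) - G (compose I a u)\<bar> \<le> 4 * \<eta>"
    if "u \<in> space (PiM I (\<lambda>_. unit_interval))" for u
  proof -
    have u: "u i \<in> {0..<1}" if "i \<in> I" for i
      using that \<open>u \<in> _\<close> by (auto simp: space_PiM space_unit_interval)
    have au: "a (u i) < n" "\<bar>u i - real (a (u i)) / n\<bar> \<le> 1 / n" if "i \<in> I" for i
      using a(3)[OF u[OF that]] by auto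
    have pa: "real (a (u i)) / n \<in> {0..<1}" if "i \<in> I" for i
      by (rule point[OF au(1)[OF that]])
    have Y: "compose I a u \<in> Y"
      using au by (auto simp: Y_def compose_def)
    have ceq: "c (compose I a u) = compose I b (\<lambda>i. real (a (u i)) / n)"
      by (auto simp: c_def compose_def)
    have "F (compose I b u) - F (compose I b (\<lambda>i. real (a (u i)) / n)) \<le> \<eta> + \<eta> / \<kappa> * (1 / n)"
      by (intro chain u pa au)
    moreover have "F (compose I b (\<lambda>i. real (a (u i)) / n)) - F (compose I b u) \<le> \<eta> + \<eta> / \<kappa> * (1 / n)"
      by (intro chain u pa) (simp_all add: abs_minus_commute au)
    moreover have "\<eta> / \<kappa> * (1 / n) \<le> \<eta>"
    proof -
      have "\<eta> / \<kappa> * (1 / n) = 1 * l"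
        by (simp add: l_def mult.commute)
      also have "\<dots> \<le> card I * l"
        using cardI l(1) by (intro mult_right_mono) auto
      finally show ?thesis
        using l(2) by simp
    qed
    ultimately show ?thesis
      using G(2)[OF Y, unfolded ceq] l(2) by linarith
  qed
  have "junta_error unit_interval I (I - S) (\<lambda>u. F (compose I b u))
      \<le> junta_error unit_interval I (I - S) (\<lambda>u. G (compose I a u)) + ennreal (2 * (4 * \<eta>))"
    using \<open>\<eta> > 0\<close> bounded
    by (intro junta_error_close[where B = B] prob_space_unit_interval meas close
          measurable_compose[OF measurable_compose_restrict[OF a(1)] GY]) auto
  also have "junta_error unit_interval I (I - S) (\<lambda>u. G (compose I a u))
      = junta_error (uniform_count_measure {..<n}) I (I - S) G"
    by (rule junta_error_distr[symmetric, OF prob_space_unit_interval a(1,2) I(1) _ GY]) simp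
  also have "\<dots> = ennreal (grid_mean I n (\<lambda>x. \<bar>G x - grid_mean (I - S) n (\<lambda>y. G (merge_on (I - S) x y))\<bar>))"
    by (rule junta_error_uniform[OF I(1) _ n(1)]) simp
  also have "\<dots> \<le> ennreal (sqrt ?V)"
    by (intro ennreal_leI order_trans[OF grid_mean_abs_le_sqrt[OF I(1) n(1)] real_sqrt_le_mono[OF S(3)]])
  finally have "junta_error unit_interval I (I - S) (\<lambda>u. F (compose I b u))
      \<le> ennreal (sqrt ?V) + ennreal (8 * \<eta>)"
    by (simp add: add_right_mono)
  moreover have "0 \<le> L"
    using \<open>\<eta> > 0\<close> \<open>\<kappa> > 0\<close> by (simp add: L_def)
  then have "0 \<le> ?V"
    using \<open>\<delta> > 0\<close> by (intro add_nonneg_nonneg) auto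
  ultimately show ?thesis
    using S(1,2) \<open>\<eta> > 0\<close> by (intro exI[of _ S]) (simp add: ennreal_plus)
qed

text \<open>On a finite discrete space every \<open>f\<close> is measurable. The identity allows two
  different sources with the same law on \<open>Z\<close> to be exchanged.\<close>

lemma junta_error_finite_distr:
  fixes f :: "('i \<Rightarrow> 'b) \<Rightarrow> real"
  assumes P: "prob_space P" and \<phi>: "\<phi> \<in> P \<rightarrow>\<^sub>M count_space Z" and "finite Z" "finite I" "R \<subseteq> I"
  shows "junta_error (distr P (count_space Z) \<phi>) I R f = junta_error P I R (\<lambda>x. f (compose I \<phi> x))"
proof (rule junta_error_distr[OF P])
  let ?Q = "distr P (count_space Z) \<phi>"
  show "\<phi> \<in> P \<rightarrow>\<^sub>M ?Q"
    using \<phi> by simp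
  show "distr P ?Q \<phi> = ?Q"
    by (rule distr_cong) simp_all
  have "sets (PiM I (\<lambda>_. ?Q)) = sets (PiM I (\<lambda>_. count_space Z))"
    by (rule sets_PiM_cong) simp_all
  then show "f \<in> borel_measurable (PiM I (\<lambda>_. ?Q))"
    using measurable_finite_valued[OF assms(4,3), of f] measurable_cong_sets by blast
qed (fact assms(4,5))+

text \<open>The choices are made in the order \<open>\<eta>\<close>, \<open>\<delta>\<close>, the
  walk with its \<open>\<kappa>\<close>, \<open>L\<close>, \<open>d\<close>,
  \<open>\<theta>\<close>, \<open>p\<close>; \<open>N\<close> and \<open>f\<close> appear only
  afterwards, so \<open>p\<close> is uniform in them. The limit of \<open>\<omega>\<close> at 0
  yields both the scale \<open>\<delta>\<close> and the uniform continuity that makes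
  \<open>f\<close> measurable and bounded.\<close>

theorem theorem1p1:
  fixes \<mu> :: "'a::metric_space measure" and \<omega> :: "real \<Rightarrow> ennreal"
  assumes "metric_prob_space \<mu>"
    and "connected (spt \<mu>)"
    and "locally connected (spt \<mu>)"
    and "mono_on {0..} \<omega>"
    and "(\<omega> \<longlongrightarrow> 0) (at_right 0)"
  shows "\<forall>\<epsilon>::real. \<epsilon> > 0 \<longrightarrow>
    (\<exists>p::nat. p \<ge> 1 \<and>
      (\<forall>N::nat. N \<ge> 1 \<longrightarrow>
        (\<forall>f :: (nat \<Rightarrow> 'a) \<Rightarrow> real.
          (\<forall>r\<ge>0. modulus_of_continuity (pow_space N) (dist_inf N) f r \<le> \<omega> r) \<longrightarrow>
          (\<exists>S. S \<subseteq> {1..N} \<and> card S \<le> p \<and>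
            L1_norm (pow_measure N \<mu>) (\<lambda>x. f x - cond_exp_on N \<mu> S f x) < ennreal \<epsilon>))))"
proof (intro allI impI)
  fix \<epsilon> :: real assume \<epsilon>: "\<epsilon> > 0"
  \<comment> \<open>The final error is \<open>\<epsilon> / 4\<close> from Friedgut's inequality plus
    \<open>8 * \<eta> + 2 * \<eta> = \<epsilon> / 4\<close> from the discretisation, in total
    \<open>\<epsilon> / 2\<close>.\<close>
  define \<eta> where "\<eta> = \<epsilon> / 40"
  have \<eta>: "\<eta> > 0"
    using \<epsilon> by (simp add: \<eta>_def)
  have small: "\<exists>\<delta>>0. \<forall>r. 0 < r \<and> r \<le> \<delta> \<longrightarrow> \<omega> r < ennreal c" if "c > 0" for c
  proof -
    have "\<forall>\<^sub>F r in at_right 0. \<omega> r < ennreal c"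
      using that by (intro order_tendstoD(2)[OF assms(5)]) simp
    then obtain \<delta> where "\<delta> > 0" "\<And>r. 0 < r \<Longrightarrow> r < \<delta> \<Longrightarrow> \<omega> r < ennreal c"
      by (auto simp: eventually_at_right_field)
    then show ?thesis
      by (intro exI[of _ "\<delta> / 2"]) auto
  qed
  obtain \<delta>0 where \<delta>0: "\<delta>0 > 0" "\<omega> \<delta>0 < ennreal \<eta>"
    using small[OF \<eta>] by blast
  \<comment> \<open>Walk steps are shorter than \<open>6 * \<delta>\<close>; the rounding distance
    \<open>2 * \<delta>\<close> also fits within \<open>\<delta>0\<close>.\<close>
  define \<delta> where "\<delta> = \<delta>0 / 6"
  have \<delta>: "\<delta> > 0" "6 * \<delta> = \<delta>0"
    using \<delta>0 by (simp_all add: \<delta>_def)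
  have K: "compact (UNIV :: 'a set)" and prob: "prob_space \<mu>" and sets: "sets \<mu> = sets borel"
    using assms(1) by (auto simp: metric_prob_space_def)
  have space: "space \<mu> = UNIV"
    using sets_eq_imp_space_eq[OF sets] by simp
  show "\<exists>p::nat. p \<ge> 1 \<and> (\<forall>N::nat. N \<ge> 1 \<longrightarrow> (\<forall>f :: (nat \<Rightarrow> 'a) \<Rightarrow> real.
      (\<forall>r\<ge>0. modulus_of_continuity (pow_space N) (dist_inf N) f r \<le> \<omega> r) \<longrightarrow>
      (\<exists>S. S \<subseteq> {1..N} \<and> card S \<le> p \<and>
        L1_norm (pow_measure N \<mu>) (\<lambda>x. f x - cond_exp_on N \<mu> S f x) < ennreal \<epsilon>)))"
  proof (rule interval_walk_model[OF assms(1,2) \<delta>(1)])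
    fix Z :: "'a set" and \<rho> r :: "'a \<Rightarrow> 'a" and w :: "nat \<Rightarrow> 'a" and b \<kappa>
    assume Z: "finite Z" and \<rho>: "\<rho> \<in> \<mu> \<rightarrow>\<^sub>M \<mu>" "distr \<mu> \<mu> \<rho> = \<mu>" and r: "r \<in> \<mu> \<rightarrow>\<^sub>M count_space Z"
      and \<rho>r: "\<And>x. dist (\<rho> x) (r x) < 2 * \<delta>" and w: "\<And>s. dist (w s) (w (Suc s)) < 6 * \<delta>"
      and wb: "(\<lambda>u. w (b u)) \<in> unit_interval \<rightarrow>\<^sub>M count_space Z"
      and law: "distr unit_interval (count_space Z) (\<lambda>u. w (b u)) = distr \<mu> (count_space Z) r"
      and \<kappa>: "\<kappa> > 0"
      and b: "\<And>u v. u \<in> {0..<1} \<Longrightarrow> v \<in> {0..<1} \<Longrightarrow> real (b u) \<le> real (b v) + 1 + \<bar>u - v\<bar> / \<kappa>"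
    define L where "L = 6 * \<eta> / \<kappa>"
    have L: "L > 0"
      using \<eta> \<kappa> by (simp add: L_def)
    \<comment> \<open>The high degrees get the share \<open>\<epsilon>^2 / 32\<close>, and the
      choice of \<open>\<theta>\<close> gives the low degrees the same; together they make
      \<open>(\<epsilon> / 4)^2\<close>.\<close>
    obtain d :: nat where d: "32 * L\<^sup>2 / \<epsilon>\<^sup>2 < d"
      using reals_Archimedean2 by blast
    have high: "L\<^sup>2 / (real d + 1) \<le> \<epsilon>\<^sup>2 / 32"
    proof -
      have "32 * L\<^sup>2 < real d * \<epsilon>\<^sup>2"
        using d \<epsilon> by (simp add: field_simps)
      also have "\<dots> \<le> (real d + 1) * \<epsilon>\<^sup>2"
        by (simp add: mult_right_mono)
      finally show ?thesis
        by (simp add: field_simps)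
    qed
    \<comment> \<open>\<open>t\<close> is the value of \<open>sqrt (L * \<theta>)\<close> at which
      the low-degree term equals \<open>\<epsilon>^2 / 32\<close>; solving for
      \<open>\<theta>\<close> gives the next definition.\<close>
    define t where "t = \<epsilon>\<^sup>2 / (32 * 3 ^ d * L)"
    define \<theta> where "\<theta> = t\<^sup>2 / L"
    have "t > 0"
      using \<epsilon> L by (simp add: t_def)
    then have \<theta>: "\<theta> > 0" "sqrt (L * \<theta>) = t"
      using L by (simp_all add: \<theta>_def)
    then have low: "3 ^ d * (L * sqrt (L * \<theta>)) = \<epsilon>\<^sup>2 / 32"
      using L by (simp add: t_def)
    have "L\<^sup>2 / (real d + 1) + 3 ^ d * (L * sqrt (L * \<theta>)) \<le> \<epsilon>\<^sup>2 / 32 + \<epsilon>\<^sup>2 / 32"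
      unfolding low by (rule add_right_mono[OF high])
    also have "\<dots> = (\<epsilon> / 4)\<^sup>2"
      by (simp add: power_divide)
    finally have "sqrt (L\<^sup>2 / (real d + 1) + 3 ^ d * (L * sqrt (L * \<theta>))) \<le> sqrt ((\<epsilon> / 4)\<^sup>2)"
      by (rule real_sqrt_le_mono)
    then have root: "sqrt (L\<^sup>2 / (real d + 1) + 3 ^ d * (L * sqrt (L * \<theta>))) \<le> \<epsilon> / 4"
      using \<epsilon> by simp
    define p where "p = nat \<lceil>L / \<theta>\<rceil> + 1"
    show ?thesis
    proof (intro exI[of _ p] conjI allI impI)
      show "p \<ge> 1"
        by (simp add: p_def)
      fix N :: nat and f :: "(nat \<Rightarrow> 'a) \<Rightarrow> real"
      assume N: "N \<ge> 1"
        and f: "\<forall>r\<ge>0. modulus_of_continuity (pow_space N) (dist_inf N) f r \<le> \<omega> r"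
      define I where "I = {1..N}"
      have I: "finite I" "I \<noteq> {}"
        using N by (auto simp: I_def)
      have pow: "pow_space N = PiE I (\<lambda>_. UNIV)" "pow_measure N \<mu> = PiM I (\<lambda>_. \<mu>)"
        by (simp_all add: pow_space_def pow_measure_def I_def)
      have spaceI: "space (PiM I (\<lambda>_. \<mu>)) = PiE I (\<lambda>_. UNIV)"
        by (simp add: space_PiM space)
      have osc: "\<bar>f x - f y\<bar> \<le> c"
        if "x \<in> PiE I (\<lambda>_. UNIV)" "y \<in> PiE I (\<lambda>_. UNIV)" "\<And>i. i \<in> I \<Longrightarrow> dist (x i) (y i) \<le> s"
          "0 < s" "\<omega> s < ennreal c" for x y s c
      proof -
        have "dist_inf N x y \<le> s"
          using that(3) by (intro dist_inf_le[OF N]) (simp add: I_def)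
        moreover have "modulus_of_continuity (pow_space N) (dist_inf N) f s \<le> \<omega> s"
          using f that(4) by simp
        ultimately have "ennreal \<bar>f x - f y\<bar> \<le> \<omega> s"
          using that(1,2) unfolding pow(1)[symmetric]
          by (intro modulus_of_continuityD[of "pow_space N" "dist_inf N"])
        then have "ennreal \<bar>f x - f y\<bar> < ennreal c"
          using that(5) by (rule le_less_trans)
        then show ?thesis
          by (simp add: ennreal_less_iff)
      qed
      note osc\<eta> = osc[of _ _ \<delta>0 \<eta>, OF _ _ _ \<delta>0]
      have uc: "\<exists>\<delta>>0. \<forall>x y. x \<in> PiE I (\<lambda>_. UNIV) \<longrightarrow> y \<in> PiE I (\<lambda>_. UNIV) \<longrightarrow>
          (\<forall>i\<in>I. dist (x i) (y i) \<le> \<delta>) \<longrightarrow> \<bar>f x - f y\<bar> \<le> c" if c: "c > 0" for c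
      proof -
        obtain s where s: "s > 0" "\<forall>r. 0 < r \<and> r \<le> s \<longrightarrow> \<omega> r < ennreal c"
          using small[OF c] by blast
        show ?thesis
          by (intro exI[of _ s] conjI allI impI osc[of _ _ s c] s(1)) (use s in auto)
      qed
      have f_meas: "f \<in> borel_measurable (PiM I (\<lambda>_. \<mu>))"
        by (rule uniformly_continuous_product_measurable(1)[OF sets K I(1) uc])
      obtain B where B: "\<And>x. x \<in> PiE I (\<lambda>_. UNIV) \<Longrightarrow> \<bar>f x\<bar> \<le> B"
        using uniformly_continuous_product_measurable(2)[OF sets K I(1) uc] by blast
      have comp: "compose I \<phi> x \<in> PiE I (\<lambda>_. UNIV)" for \<phi> :: "'b \<Rightarrow> 'a" and x
        by (simp add: compose_def)
      define F where "F s = f (compose I w s)" for s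
      have Fb: "F (compose I b u) = f (compose I (\<lambda>u. w (b u)) u)" for u
        unfolding F_def by (rule arg_cong[where f = f]) (auto simp: compose_def)
      have "\<exists>S\<subseteq>I. \<theta> * card S \<le> L \<and>
        junta_error unit_interval I (I - S) (\<lambda>u. F (compose I b u))
          \<le> ennreal (sqrt (L\<^sup>2 / (real d + 1) + 3 ^ d * (L * sqrt (L * \<theta>))) + 8 * \<eta>)"
        unfolding L_def
      proof (rule uniform_grid_junta[OF I \<eta> \<kappa> \<theta>(1) _ b, where B = B])
        fix s s' assume adj: "adjacent_on I s s'"
        show "\<bar>F s - F s'\<bar> \<le> \<eta>"
          unfolding F_def
        proof (rule osc\<eta>[OF comp comp])
          fix i assume i: "i \<in> I"
          then have "s i = s' i \<or> s i = Suc (s' i) \<or> s' i = Suc (s i)"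
            using adj by (force simp: adjacent_on_def)
          then show "dist (compose I w s i) (compose I w s' i) \<le> \<delta>0"
            using w[of "s i"] w[of "s' i"] \<delta> \<delta>0(1) i by (auto simp: compose_def dist_commute)
        qed
      next
        show "(\<lambda>u. F (compose I b u)) \<in> borel_measurable (PiM I (\<lambda>_. unit_interval))"
          unfolding Fb
          by (rule measurable_compose[OF measurable_compose_restrict[OF wb] measurable_finite_valued[OF I(1) Z]])
        show "\<bar>F (compose I b u)\<bar> \<le> B" for u
          unfolding Fb by (rule B[OF comp])
      qed
      then obtain S where S: "S \<subseteq> I" "\<theta> * card S \<le> L"
        "junta_error unit_interval I (I - S) (\<lambda>u. F (compose I b u))
          \<le> ennreal (sqrt (L\<^sup>2 / (real d + 1) + 3 ^ d * (L * sqrt (L * \<theta>))) + 8 * \<eta>)"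
        by blast
      have "L1_norm (pow_measure N \<mu>) (\<lambda>x. f x - cond_exp_on N \<mu> S f x) = junta_error \<mu> I (I - S) f"
        unfolding I_def using f_meas B spaceI
        by (intro L1_norm_cond_exp_on[OF prob]) (simp_all add: pow)
      \<comment> \<open>The rounding \<open>r\<close> is known to be close to \<open>\<rho>\<close>,
        not to the identity, so \<open>f\<close> is composed with the measure-preserving
        \<open>\<rho>\<close> before rounding.\<close>
      also have "\<dots> = junta_error \<mu> I (I - S) (\<lambda>x. f (compose I \<rho> x))"
        by (rule junta_error_distr[OF prob \<rho> I(1) _ f_meas]) simp
      also have "\<dots> \<le> junta_error \<mu> I (I - S) (\<lambda>x. f (compose I r x)) + ennreal (2 * \<eta>)"
      proof (rule junta_error_close[OF prob])
        show "(\<lambda>x. f (compose I \<rho> x)) \<in> borel_measurable (PiM I (\<lambda>_. \<mu>))"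
          by (rule measurable_compose[OF measurable_compose_restrict[OF \<rho>(1)] f_meas])
        show "(\<lambda>x. f (compose I r x)) \<in> borel_measurable (PiM I (\<lambda>_. \<mu>))"
          by (rule measurable_compose[OF measurable_compose_restrict[OF r] measurable_finite_valued[OF I(1) Z]])
        show "\<bar>f (compose I \<rho> x) - f (compose I r x)\<bar> \<le> \<eta>" for x
        proof (rule osc\<eta>[OF comp comp])
          fix i assume "i \<in> I"
          then show "dist (compose I \<rho> x i) (compose I r x i) \<le> \<delta>0"
            using \<rho>r[of "x i"] \<delta> by (simp add: compose_def)
        qed
      qed (use B[OF comp] \<eta> in auto)
      \<comment> \<open>Both sides are the error under one and the same law on the finite set
        \<open>Z\<close>, that of \<open>r\<close> and of the walk.\<close>
      also have "junta_error \<mu> I (I - S) (\<lambda>x. f (compose I r x))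
          = junta_error unit_interval I (I - S) (\<lambda>u. F (compose I b u))"
        unfolding Fb
        using junta_error_finite_distr[OF prob r Z I(1), of "I - S" f]
          junta_error_finite_distr[OF prob_space_unit_interval wb Z I(1), of "I - S" f] law by simp
      also have "\<dots> + ennreal (2 * \<eta>) \<le> ennreal (\<epsilon> / 4 + 8 * \<eta>) + ennreal (2 * \<eta>)"
        using root by (intro add_right_mono order_trans[OF S(3)] ennreal_leI) simp
      also have "\<dots> = ennreal (\<epsilon> / 2)"
        using \<epsilon> by (simp add: \<eta>_def flip: ennreal_plus)
      also have "\<dots> < ennreal \<epsilon>"
        using \<epsilon> by (simp add: ennreal_less_iff)
      finally have "L1_norm (pow_measure N \<mu>) (\<lambda>x. f x - cond_exp_on N \<mu> S f x) < ennreal \<epsilon>" .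
      moreover have "card S \<le> p"
      proof -
        have "real (card S) \<le> L / \<theta>"
          using S(2) \<theta>(1) by (simp add: field_simps)
        then show ?thesis
          unfolding p_def by linarith
      qed
      ultimately show "\<exists>S. S \<subseteq> {1..N} \<and> card S \<le> p \<and>
          L1_norm (pow_measure N \<mu>) (\<lambda>x. f x - cond_exp_on N \<mu> S f x) < ennreal \<epsilon>"
        using S(1) unfolding I_def by blast
    qed
  qed
qed

end
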